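(* Let $(W,S)$ be a finite Coxeter system, $c$ a Coxeter element with reduced word $\mathbf{c}$, $s$ an initial letter of $c$, and $c'=scs$ with reduced word $\mathbf{c}'$. Let $\beta_1,\beta_2\in\Phi_{\geq-1}$. Then $\{\beta_1,\beta_2\}$ is a face of $\Delta(\mathbf{c}\mathbf{w}_\circ(\mathbf{c}),w_\circ)$ (positions identified with $\Phi_{\geq-1}$ via $\mathsf{Lr}_c$) if and only if $\{\sigma_s(\beta_1),\sigma_s(\beta_2)\}$ is a face of $\Delta(\mathbf{c}'\mathbf{w}_\circ(\mathbf{c}'),w_\circ)$ (positions identified with $\Phi_{\geq-1}$ via $\mathsf{Lr}_{c'}$).
   Context: $s$ is initial in $c$ if $\ell(sc)<\ell(c)$. $W$ acts on $V$ with simple roots $\{\alpha_t\}$, root system $\Phi$, positive roots $\Phi^+$, and $\Phi_{\geq-1}=\Phi^+\cup\{-\alpha_t:t\in S\}$. The involution $\sigma_s$ of $\Phi_{\geq-1}$ is $\sigma_s(\beta)=\beta$ if $-\beta\in\{\alpha_t : t\neq s\}$, and $\sigma_s(\beta)=s(\beta)$ otherwise. $w_\circ$ is the longest element, $N=\ell(w_\circ)$. For a Coxeter element $d$ with reduced word $\mathbf{d}=(d_1,\dots,d_n)$, $\mathbf{w}_\circ(\mathbf{d})=(w_1,\dots,w_N)$ is the lexicographically first (as a sequence of positions) subword of $\mathbf{d}\mathbf{d}\cdots$ which is a reduced expression for $w_\circ$, and $\mathsf{Lr}_d$ is the bijection from positions of $(d_1,\dots,d_n,w_1,\dots,w_N)$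 to $\Phi_{\geq-1}$ sending $d_i\mapsto-\alpha_{d_i}$ and $w_i\mapsto w_1\cdots w_{i-1}(\alpha_{w_i})$. For a word $Q$ and $\pi\in W$, $\Delta(Q,\pi)$ is the simplicial complex on the positions of $Q$ whose faces are the sets $P$ of positions such that deleting them leaves a word containing a reduced expression for $\pi$ as a subword. *)

theory Defs
  imports
    "HOL-Analysis.Analysis"
    "HOL-Algebra.Group_Action"
    "HOL-Algebra.Generated_Groups"
    "HOL-Library.Sublist"
begin

definition word_prod :: "('a, 'b) monoid_scheme \<Rightarrow> 'a list \<Rightarrow> 'a" where
  "word_prod W ws = foldr (\<otimes>\<^bsub>W\<^esub>) ws \<one>\<^bsub>W\<^esub>"

text \<open>The entry 0 encodes \<open>m(s,t) = \<infinity>\<close>.\<close>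

definition coxeter_matrix :: "'a set \<Rightarrow> ('a \<Rightarrow> 'a \<Rightarrow> nat) \<Rightarrow> bool" where
  "coxeter_matrix S m \<longleftrightarrow>
     (\<forall>s\<in>S. m s s = 1) \<and> (\<forall>s\<in>S. \<forall>t\<in>S. m s t = m t s \<and> (s \<noteq> t \<longrightarrow> m s t \<noteq> 1))"

text \<open>The congruence on words generated by the relations \<open>(st)\<^bsup>m(s,t)\<^esup> = 1\<close>. Since
  \<open>m(s,s) = 1\<close> makes every generator its own inverse, the monoid presented in this way
  is the group with the same presentation.\<close>

inductive coxeter_equiv :: "'a set \<Rightarrow> ('a \<Rightarrow> 'a \<Rightarrow> nat) \<Rightarrow> 'a list \<Rightarrow> 'a list \<Rightarrow> bool"
  for S m where
  rel: "s \<in> S \<Longrightarrow> t \<in> S \<Longrightarrow>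
          coxeter_equiv S m (u @ concat (replicate (m s t) [s, t]) @ v) (u @ v)"
| refl: "coxeter_equiv S m u u"
| sym: "coxeter_equiv S m u v \<Longrightarrow> coxeter_equiv S m v u"
| trans: "coxeter_equiv S m u v \<Longrightarrow> coxeter_equiv S m v w \<Longrightarrow> coxeter_equiv S m u w"

definition coxeter_system :: "('a, 'b) monoid_scheme \<Rightarrow> 'a set \<Rightarrow> bool" where
  "coxeter_system W S \<longleftrightarrow>
     group W \<and> S \<subseteq> carrier W \<and> generate W S = carrier W \<and>
     (\<exists>m. coxeter_matrix S m \<and>
        (\<forall>u\<in>lists S. \<forall>v\<in>lists S. word_prod W u = word_prod W v \<longleftrightarrow> coxeter_equiv S m u v))"

definition finite_coxeter_system :: "('a, 'b) monoid_scheme \<Rightarrow> 'a set \<Rightarrow> bool" where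
  "finite_coxeter_system W S \<longleftrightarrow> coxeter_system W S \<and> finite (carrier W)"

definition cox_length :: "('a, 'b) monoid_scheme \<Rightarrow> 'a set \<Rightarrow> 'a \<Rightarrow> nat" where
  "cox_length W S w = (LEAST k. \<exists>ws\<in>lists S. length ws = k \<and> word_prod W ws = w)"

definition reduced_word :: "('a, 'b) monoid_scheme \<Rightarrow> 'a set \<Rightarrow> 'a list \<Rightarrow> 'a \<Rightarrow> bool" where
  "reduced_word W S ws w \<longleftrightarrow>
     ws \<in> lists S \<and> word_prod W ws = w \<and> length ws = cox_length W S w"

definition longest_element :: "('a, 'b) monoid_scheme \<Rightarrow> 'a set \<Rightarrow> 'a" where
  "longest_element W S =
     (THE w. w \<in> carrier W \<and> (\<forall>u\<in>carrier W. cox_length W S u \<le> cox_length W S w))"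

definition coxeter_element :: "('a, 'b) monoid_scheme \<Rightarrow> 'a set \<Rightarrow> 'a \<Rightarrow> bool" where
  "coxeter_element W S c \<longleftrightarrow> (\<exists>ws. distinct ws \<and> set ws = S \<and> word_prod W ws = c)"

definition initial_letter :: "('a, 'b) monoid_scheme \<Rightarrow> 'a set \<Rightarrow> 'a \<Rightarrow> 'a \<Rightarrow> bool" where
  "initial_letter W S s c \<longleftrightarrow> s \<in> S \<and> cox_length W S (s \<otimes>\<^bsub>W\<^esub> c) < cox_length W S c"

definition reflection :: "'v::euclidean_space \<Rightarrow> 'v \<Rightarrow> 'v" where
  "reflection a v = v - (2 * (v \<bullet> a) / (a \<bullet> a)) *\<^sub>R a"

text \<open>Reduced root systems of finite reflection groups, not necessarily crystallographic
  and not necessarily spanning the ambient space.\<close>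

definition root_system :: "'v::euclidean_space set \<Rightarrow> bool" where
  "root_system \<Phi> \<longleftrightarrow>
     finite \<Phi> \<and> 0 \<notin> \<Phi> \<and> (\<forall>a\<in>\<Phi>. \<Phi> \<inter> span {a} = {a, - a} \<and> reflection a ` \<Phi> = \<Phi>)"

definition pos_roots :: "'a set \<Rightarrow> ('a \<Rightarrow> 'v::euclidean_space) \<Rightarrow> 'v set \<Rightarrow> 'v set" where
  "pos_roots S \<alpha> \<Phi> = {\<beta>\<in>\<Phi>. \<exists>k. (\<forall>t\<in>S. 0 \<le> k t) \<and> \<beta> = (\<Sum>t\<in>S. k t *\<^sub>R \<alpha> t)}"

definition simple_roots :: "'a set \<Rightarrow> ('a \<Rightarrow> 'v::euclidean_space) \<Rightarrow> 'v set \<Rightarrow> bool" where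
  "simple_roots S \<alpha> \<Phi> \<longleftrightarrow>
     inj_on \<alpha> S \<and> \<alpha> ` S \<subseteq> \<Phi> \<and> independent (\<alpha> ` S) \<and>
     (\<forall>\<beta>\<in>\<Phi>. \<beta> \<in> pos_roots S \<alpha> \<Phi> \<or> - \<beta> \<in> pos_roots S \<alpha> \<Phi>)"

text \<open>\<open>W\<close> acts on \<open>V\<close> as a finite reflection group with root system \<open>\<Phi>\<close>, each \<open>t \<in> S\<close>
  acting as the reflection in the simple root \<open>\<alpha> t\<close>. Faithfulness ensures that \<open>\<Phi>\<close> is a
  root system of \<open>W\<close> itself and not of a proper quotient.\<close>

definition reflection_action ::
  "('a, 'b) monoid_scheme \<Rightarrow> 'a set \<Rightarrow> ('a \<Rightarrow> 'v \<Rightarrow> 'v) \<Rightarrow> ('a \<Rightarrow> 'v::euclidean_space) \<Rightarrow> 'v set \<Rightarrow> bool"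
where
  "reflection_action W S act \<alpha> \<Phi> \<longleftrightarrow>
     root_system \<Phi> \<and> simple_roots S \<alpha> \<Phi> \<and>
     faithful_action W UNIV act \<and> (\<forall>t\<in>S. act t = reflection (\<alpha> t))"

definition almost_pos_roots :: "'a set \<Rightarrow> ('a \<Rightarrow> 'v::euclidean_space) \<Rightarrow> 'v set \<Rightarrow> 'v set" where
  "almost_pos_roots S \<alpha> \<Phi> = pos_roots S \<alpha> \<Phi> \<union> {- \<alpha> t | t. t \<in> S}"

definition root_sigma ::
  "'a set \<Rightarrow> ('a \<Rightarrow> 'v \<Rightarrow> 'v) \<Rightarrow> ('a \<Rightarrow> 'v::euclidean_space) \<Rightarrow> 'a \<Rightarrow> 'v \<Rightarrow> 'v" where
  "root_sigma S act \<alpha> s \<beta> = (if - \<beta> \<in> {\<alpha> t | t. t \<in> S \<and> t \<noteq> s} then \<beta> else act s \<beta>)"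

text \<open>Positions in words are counted from 0. The letter of the infinite word \<open>d d d \<dots>\<close>
  at position \<open>i\<close> is \<open>d ! (i mod length d)\<close>.\<close>

definition longest_positions ::
  "('a, 'b) monoid_scheme \<Rightarrow> 'a set \<Rightarrow> 'a list \<Rightarrow> nat list \<Rightarrow> bool" where
  "longest_positions W S d ps \<longleftrightarrow>
     sorted_wrt (<) ps \<and>
     reduced_word W S (map (\<lambda>i. d ! (i mod length d)) ps) (longest_element W S)"

definition sorting_positions :: "('a, 'b) monoid_scheme \<Rightarrow> 'a set \<Rightarrow> 'a list \<Rightarrow> nat list" where
  "sorting_positions W S d =
     (THE ps. longest_positions W S d ps \<and>
        (\<forall>qs. longest_positions W S d qs \<longrightarrow> ps = qs \<or> (ps, qs) \<in> lexord less_than))"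

definition sorting_word :: "('a, 'b) monoid_scheme \<Rightarrow> 'a set \<Rightarrow> 'a list \<Rightarrow> 'a list" where
  "sorting_word W S d = map (\<lambda>i. d ! (i mod length d)) (sorting_positions W S d)"

definition Lr ::
  "('a, 'b) monoid_scheme \<Rightarrow> 'a set \<Rightarrow> ('a \<Rightarrow> 'v \<Rightarrow> 'v) \<Rightarrow> ('a \<Rightarrow> 'v::euclidean_space) \<Rightarrow>
     'a list \<Rightarrow> nat \<Rightarrow> 'v" where
  "Lr W S act \<alpha> d i =
     (if i < length d then - \<alpha> (d ! i)
      else let w = sorting_word W S d; j = i - length d
           in act (word_prod W (take j w)) (\<alpha> (w ! j)))"

definition subword_complex ::
  "('a, 'b) monoid_scheme \<Rightarrow> 'a set \<Rightarrow> 'a list \<Rightarrow> 'a \<Rightarrow> nat set set" where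
  "subword_complex W S Q \<pi> =
     {P. P \<subseteq> {..<length Q} \<and> (\<exists>u. reduced_word W S u \<pi> \<and> subseq u (nths Q (- P)))}"

text \<open>The complex of the word \<open>d w\<^sub>\<circ>(d)\<close> for the longest element, with positions
  identified with almost positive roots.\<close>

definition root_subword_complex ::
  "('a, 'b) monoid_scheme \<Rightarrow> 'a set \<Rightarrow> ('a \<Rightarrow> 'v \<Rightarrow> 'v) \<Rightarrow> ('a \<Rightarrow> 'v::euclidean_space) \<Rightarrow>
     'a list \<Rightarrow> 'v set set" where
  "root_subword_complex W S act \<alpha> d =
     (\<lambda>P. Lr W S act \<alpha> d ` P) `
       subword_complex W S (d @ sorting_word W S d) (longest_element W S)"

end

theory Submission
  imports Defs
begin

text \<open>Rotating the first letter \<open>s\<close> of a word to its end as \<open>w\<^sub>\<circ> s w\<^sub>\<circ>\<close> preserves the property of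
  containing a reduced word for \<open>w\<^sub>\<circ>\<close>, and exchanging adjacent commuting letters preserves it
  too. If \<open>c = s d\<close>, rotating \<open>c w\<^sub>\<circ>(c)\<close> changes the root labels by \<open>\<sigma>\<^sub>s\<close>, so what has to be
  shown is that the result is \<open>c' w\<^sub>\<circ>(c')\<close> up to commutations, where \<open>c' = d s\<close>.

  This is controlled by the skew-symmetric form \<open>\<omega>\<^sub>c\<close> with
  \<open>\<omega>\<^sub>c(\<alpha>\<^sub>s, \<alpha>\<^sub>t) = - \<langle>\<alpha>\<^sub>s, \<alpha>\<^sub>t\<rangle>\<close> for \<open>s\<close> before \<open>t\<close> in \<open>c\<close>, which satisfies
  \<open>\<omega>\<^bsub>c'\<^esub>(s x, s y) = \<omega>\<^sub>c(x, y)\<close> and is nonnegative on \<open>(\<alpha>\<^sub>s, \<beta>)\<close> for \<open>s\<close> initial and \<open>\<beta>\<close>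
  positive. Applying the letters of \<open>ccc\<dots>\<close> one by one to a positive root, call the root dead
  once it has become negative. A root that dies earlier pairs nonnegatively with one that dies
  later, and a zero pairing forces orthogonality; from this, the greedy reduced subword of
  \<open>ccc\<dots>\<close> lists the positive roots in the order in which they die. Hence any two orders of
  the positive roots that are compatible with \<open>\<omega>\<^sub>c\<close> differ only in orthogonal pairs, and the
  corresponding words only by commutations.\<close>

subsection \<open>Reflections and words in simple reflections\<close>

lemma linear_reflection: "linear (reflection a)"
  unfolding reflection_def
  by (rule linearI) (auto simp: inner_add_left algebra_simps add_divide_distrib)

lemma reflection_reflection [simp]: "a \<noteq> 0 \<Longrightarrow> reflection a (reflection a v) = v"
  unfolding reflection_def by (simp add: inner_diff_left field_simps)

lemma inner_reflection_reflection [simp]: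
  "a \<noteq> 0 \<Longrightarrow> reflection a u \<bullet> reflection a v = u \<bullet> v"
  unfolding reflection_def
  by (simp add: inner_diff_left inner_diff_right field_simps inner_commute)

lemma reflection_self [simp]: "a \<noteq> 0 \<Longrightarrow> reflection a a = - a"
  unfolding reflection_def by (simp add: scaleR_2)

lemma reflection_minus: "reflection a (- v) = - reflection a v"
  by (simp add: linear_neg linear_reflection)

lemma reflection_orthogonal: "v \<bullet> a = 0 \<Longrightarrow> reflection a v = v"
  unfolding reflection_def by simp

lemma reflection_commute:
  "a \<bullet> b = 0 \<Longrightarrow> reflection a (reflection b v) = reflection b (reflection a v)"
  unfolding reflection_def
  by (simp add: inner_diff_left inner_commute[of b a])

lemma reflection_conjugate:
  assumes "linear f" and "\<And>u v. f u \<bullet> f v = u \<bullet> v"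
  shows "reflection (f a) (f v) = f (reflection a v)"
  unfolding reflection_def
  by (simp add: assms linear_diff linear_scale)

section \<open>Simple coordinates and positivity of roots\<close>

locale root_basis =
  fixes S :: "'a set" and \<alpha> :: "'a \<Rightarrow> 'v::euclidean_space" and \<Phi> :: "'v set"
  assumes root_system: "root_system \<Phi>"
    and simple_roots: "simple_roots S \<alpha> \<Phi>"
begin

abbreviation P :: "'v set" where "P \<equiv> pos_roots S \<alpha> \<Phi>"

abbreviation refl :: "'a \<Rightarrow> 'v \<Rightarrow> 'v" where "refl x \<equiv> reflection (\<alpha> x)"

text \<open>The simple roots need not span the ambient space, so the dual functional is chosen by
  linear extension. Its values are determined only on the span of the simple roots, which contains
  every root.\<close>

definition coord :: "'a \<Rightarrow> 'v \<Rightarrow> real" where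
  "coord t = (SOME f. linear f \<and> (\<forall>u\<in>S. f (\<alpha> u) = (if u = t then 1 else 0)))"

lemma inj_simple: "inj_on \<alpha> S"
  and simple_root [simp]: "t \<in> S \<Longrightarrow> \<alpha> t \<in> \<Phi>"
  and independent_simple: "independent (\<alpha> ` S)"
  and root_cases: "b \<in> \<Phi> \<Longrightarrow> b \<in> P \<or> - b \<in> P"
  using simple_roots unfolding simple_roots_def by auto

lemma finite_S [simp]: "finite S"
  using independent_simple inj_simple independent_imp_finite finite_imageD by blast

lemma finite_roots [simp]: "finite \<Phi>"
  and root_nonzero: "b \<in> \<Phi> \<Longrightarrow> b \<noteq> 0"
  and reduced_roots: "a \<in> \<Phi> \<Longrightarrow> \<Phi> \<inter> span {a} = {a, - a}"
  and reflection_roots: "a \<in> \<Phi> \<Longrightarrow> reflection a ` \<Phi> = \<Phi>"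
  using root_system unfolding root_system_def by auto

lemma simple_nonzero [simp]: "t \<in> S \<Longrightarrow> \<alpha> t \<noteq> 0"
  using root_nonzero simple_root by metis

lemma coord_dual_basis: "linear (coord t) \<and> (\<forall>u\<in>S. coord t (\<alpha> u) = (if u = t then 1 else 0))"
proof -
  obtain g :: "'v \<Rightarrow> real" where g: "linear g"
    "\<forall>b\<in>\<alpha> ` S. g b = (if b = \<alpha> t \<and> t \<in> S then 1 else 0)"
    using linear_independent_extend[OF independent_simple,
      of "\<lambda>b. if b = \<alpha> t \<and> t \<in> S then 1 else 0 :: real"] by blast
  have "\<forall>u\<in>S. g (\<alpha> u) = (if u = t then 1 else 0)"
    using g(2) inj_simple unfolding inj_on_def by auto
  with g(1) have "\<exists>f::'v \<Rightarrow> real. linear f \<and> (\<forall>u\<in>S. f (\<alpha> u) = (if u = t then 1 else 0))"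
    by blast
  then show ?thesis unfolding coord_def by (rule someI_ex)
qed

lemma linear_coord: "linear (coord t)" using coord_dual_basis by blast

lemma coord_simple [simp]: "u \<in> S \<Longrightarrow> coord t (\<alpha> u) = (if u = t then 1 else 0)"
  using coord_dual_basis by blast

lemma coord_minus [simp]: "coord t (- v) = - coord t v"
  by (simp add: linear_coord linear_neg)

lemma coord_lincomb:
  assumes "t \<in> S" shows "coord t (\<Sum>u\<in>S. k u *\<^sub>R \<alpha> u) = k t"
proof -
  have "coord t (\<Sum>u\<in>S. k u *\<^sub>R \<alpha> u) = (\<Sum>u\<in>S. k u * coord t (\<alpha> u))"
    by (simp add: linear_coord linear_sum linear_scale)
  also have "\<dots> = (\<Sum>u\<in>S. if u = t then k u else 0)" by (rule sum.cong) auto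
  finally show ?thesis using assms by (simp add: sum.delta')
qed

lemma root_expand:
  assumes "b \<in> \<Phi>" shows "b = (\<Sum>t\<in>S. coord t b *\<^sub>R \<alpha> t)"
proof -
  have *: "v = (\<Sum>t\<in>S. coord t v *\<^sub>R \<alpha> t)" if v: "v \<in> P" for v
  proof -
    obtain k where k: "v = (\<Sum>t\<in>S. k t *\<^sub>R \<alpha> t)" using v unfolding pos_roots_def by blast
    show ?thesis by (subst k, rule sum.cong) (simp_all add: k coord_lincomb)
  qed
  show ?thesis
  proof (cases "b \<in> P")
    case False
    with assms root_cases have "- b \<in> P" by blast
    from *[OF this] have "b = - (\<Sum>t\<in>S. coord t (- b) *\<^sub>R \<alpha> t)" by (metis minus_minus)
    then show ?thesis by (simp add: sum_negf)
  qed (rule *)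
qed

lemma P_iff: "b \<in> P \<longleftrightarrow> b \<in> \<Phi> \<and> (\<forall>t\<in>S. 0 \<le> coord t b)"
proof
  assume "b \<in> P" then show "b \<in> \<Phi> \<and> (\<forall>t\<in>S. 0 \<le> coord t b)"
    unfolding pos_roots_def by (auto simp: coord_lincomb)
next
  assume "b \<in> \<Phi> \<and> (\<forall>t\<in>S. 0 \<le> coord t b)"
  then show "b \<in> P" unfolding pos_roots_def using root_expand by auto
qed

lemma P_root: "b \<in> P \<Longrightarrow> b \<in> \<Phi>" by (simp add: P_iff)

lemma finite_P [simp]: "finite P"
  using finite_subset[OF _ finite_roots] P_root by blast

lemma simple_P [simp]: "t \<in> S \<Longrightarrow> \<alpha> t \<in> P" by (simp add: P_iff)

lemma root_eq_0: assumes "b \<in> \<Phi>" "\<And>t. t \<in> S \<Longrightarrow> coord t b = 0" shows False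
  using root_expand[OF assms(1)] assms root_nonzero by simp

lemma neg_notin_P: assumes "b \<in> P" shows "- b \<notin> P"
proof
  assume "- b \<in> P"
  with assms have "\<And>t. t \<in> S \<Longrightarrow> coord t b = 0" by (force simp: P_iff)
  with assms show False using root_eq_0 P_root by blast
qed

lemma neg_root: "b \<in> \<Phi> \<Longrightarrow> - b \<in> \<Phi>"
  using reduced_roots by blast

lemma neg_P_iff: "b \<in> \<Phi> \<Longrightarrow> - b \<in> P \<longleftrightarrow> b \<notin> P"
  using root_cases neg_notin_P by blast

text \<open>The coordinates of a root never have mixed signs, so a single positive one
  decides.\<close>

lemma pos_coord_P: assumes "b \<in> \<Phi>" "t \<in> S" "coord t b > 0" shows "b \<in> P"
  using root_cases[OF assms(1)] assms by (force simp: P_iff)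

lemma refl_root [simp]: "t \<in> S \<Longrightarrow> b \<in> \<Phi> \<Longrightarrow> refl t b \<in> \<Phi>"
  using reflection_roots[of "\<alpha> t"] simple_root[of t] imageI[of b \<Phi> "refl t"] by metis

lemma coord_refl_other: "t \<in> S \<Longrightarrow> u \<noteq> t \<Longrightarrow> coord u (refl t v) = coord u v"
  unfolding reflection_def by (simp add: linear_coord linear_diff linear_scale)

lemma coord_refl_same:
  "t \<in> S \<Longrightarrow> coord t (refl t v) = coord t v - 2 * (v \<bullet> \<alpha> t) / (\<alpha> t \<bullet> \<alpha> t)"
  unfolding reflection_def by (simp add: linear_coord linear_diff linear_scale)

text \<open>Otherwise b would be a multiple of \<open>\<alpha> t\<close>, and in a reduced root
  system the only such roots are \<open>\<alpha> t\<close> and its negative.\<close>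

lemma P_support:
  assumes "b \<in> P" "t \<in> S" "b \<noteq> \<alpha> t" obtains u where "u \<in> S" "u \<noteq> t" "coord u b > 0"
proof (rule ccontr)
  assume "\<not> thesis"
  then have z: "\<And>u. u \<in> S \<Longrightarrow> u \<noteq> t \<Longrightarrow> coord u b = 0"
    using assms(1) that by (force simp: P_iff)
  have "b = (\<Sum>u\<in>S. coord u b *\<^sub>R \<alpha> u)" using root_expand P_root assms(1) by blast
  also have "\<dots> = (\<Sum>u\<in>S. if u = t then coord u b *\<^sub>R \<alpha> u else 0)"
    by (rule sum.cong) (auto simp: z)
  finally have "b = coord t b *\<^sub>R \<alpha> t" using assms(2) by (simp add: sum.delta')
  then have "b \<in> span {\<alpha> t}" by (metis span_base span_scale singletonI)
  then have "b \<in> {\<alpha> t, - \<alpha> t}" using reduced_roots[of "\<alpha> t"] assms P_root by auto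
  then show False using assms neg_notin_P[of "\<alpha> t"] by auto
qed

text \<open>The reflection changes only the coordinate at t, and b has a positive coordinate
  elsewhere, which survives.\<close>

lemma refl_P: assumes "b \<in> P" "t \<in> S" "b \<noteq> \<alpha> t" shows "refl t b \<in> P"
proof -
  obtain u where "u \<in> S" "u \<noteq> t" "coord u b > 0" using P_support assms by blast
  then show ?thesis using pos_coord_P[of "refl t b" u] assms P_root coord_refl_other by simp
qed

lemma refl_P_cases: "b \<in> P \<Longrightarrow> t \<in> S \<Longrightarrow> refl t b \<notin> P \<Longrightarrow> b = \<alpha> t"
  using refl_P by blast

text \<open>The root \<open>refl t (\<alpha> s)\<close> is positive, and its coordinate at t is a
  negative multiple of the inner product.\<close>

lemma inner_simple_le: assumes "s \<in> S" "t \<in> S" "s \<noteq> t" shows "\<alpha> s \<bullet> \<alpha> t \<le> 0"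
proof -
  have "\<alpha> s \<noteq> \<alpha> t" using assms inj_simple unfolding inj_on_def by blast
  then have "refl t (\<alpha> s) \<in> P" using assms refl_P by simp
  then have "0 \<le> coord t (refl t (\<alpha> s))" using assms by (simp add: P_iff)
  moreover have "\<alpha> t \<bullet> \<alpha> t > 0" using assms by simp
  ultimately show ?thesis using assms by (simp add: coord_refl_same divide_le_0_iff)
qed

section \<open>Action of words on roots, inversions and reducedness\<close>

definition wact :: "'a list \<Rightarrow> 'v \<Rightarrow> 'v" where "wact u v = foldr refl u v"

lemma wact_simps [simp]: "wact [] v = v" "wact (x # u) v = refl x (wact u v)"
  "wact (u @ w) v = wact u (wact w v)"
  by (simp_all add: wact_def)

lemma rev_in_lists [simp]: "rev u \<in> lists S \<longleftrightarrow> u \<in> lists S"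
  by (simp add: in_lists_conv_set)

lemma linear_wact: "linear (wact u)"
proof (induction u)
  case Nil
  have "wact [] = (\<lambda>v. v)" by auto
  then show ?case by (simp add: linear_id[unfolded id_def])
next
  case (Cons x u)
  have "wact (x # u) = refl x \<circ> wact u" by auto
  then show ?case using Cons linear_compose linear_reflection by metis
qed

lemma wact_minus: "wact u (- v) = - wact u v"
  by (simp add: linear_neg linear_wact)

lemma inner_wact [simp]: "u \<in> lists S \<Longrightarrow> wact u v \<bullet> wact u w = v \<bullet> w"
  by (induction u) auto

lemma wact_rev_wact [simp]: "u \<in> lists S \<Longrightarrow> wact (rev u) (wact u v) = v"
  by (induction u) auto

lemma wact_wact_rev [simp]: "u \<in> lists S \<Longrightarrow> wact u (wact (rev u) v) = v"
  using wact_rev_wact[of "rev u" v] by (simp add: in_lists_conv_set)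

lemma wact_root [simp]: "u \<in> lists S \<Longrightarrow> b \<in> \<Phi> \<Longrightarrow> wact u b \<in> \<Phi>"
  by (induction u) auto

lemma coord_wact_other: "u \<in> lists S \<Longrightarrow> t \<notin> set u \<Longrightarrow> coord t (wact u v) = coord t v"
  by (induction u) (auto simp: coord_refl_other)

text \<open>For empty g these are the roots that \<open>Lr\<close> attaches to the letters of a
  sorting word. The prefix g stands for letters already read, so that the labels of a suffix can be
  handled separately.\<close>

fun lab :: "'a list \<Rightarrow> 'a list \<Rightarrow> ('a \<times> 'v) list" where
  "lab g [] = []"
| "lab g (x # u) = (x, wact g (\<alpha> x)) # lab (g @ [x]) u"

abbreviation roots :: "'a list \<Rightarrow> 'a list \<Rightarrow> 'v list" where
  "roots g u \<equiv> map snd (lab g u)"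

lemma length_lab [simp]: "length (lab g u) = length u"
  by (induction u arbitrary: g) auto

lemma map_fst_lab [simp]: "map fst (lab g u) = u"
  by (induction u arbitrary: g) auto

lemma lab_append: "lab g (u @ w) = lab g u @ lab (g @ u) w"
  by (induction u arbitrary: g) auto

lemma nth_lab: "j < length u \<Longrightarrow> lab g u ! j = (u ! j, wact g (wact (take j u) (\<alpha> (u ! j))))"
  by (induction u arbitrary: g j) (auto simp: nth_Cons split: nat.split)

lemma lab_prefix: "lab (h @ g) u = map (map_prod id (wact h)) (lab g u)"
  by (induction u arbitrary: g) auto

lemma roots_prefix: "roots (h @ g) u = map (wact h) (roots g u)"
  by (simp add: lab_prefix)

text \<open>Reducedness expressed by roots instead of length; \<open>red_minimal\<close> and
  \<open>not_red_shorten\<close> give the agreement with minimal length.\<close>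

definition red :: "'a list \<Rightarrow> bool" where
  "red u \<longleftrightarrow> u \<in> lists S \<and> set (roots [] u) \<subseteq> P"

lemma roots_snoc: "roots [] (u @ [x]) = roots [] u @ [wact u (\<alpha> x)]"
  by (simp add: lab_append)

lemma red_snoc: "red (u @ [x]) \<longleftrightarrow> red u \<and> x \<in> S \<and> wact u (\<alpha> x) \<in> P"
  unfolding red_def roots_snoc by auto

text \<open>Appending x applies one more reflection, which changes only the signs of
  \<open>\<alpha> x\<close> and its negative. An earlier inversion could become positive again only
  if it were the negative of the new root, but both are positive.\<close>

lemma red_inversions:
  "red u \<Longrightarrow> distinct (roots [] u) \<and> (\<forall>b\<in>set (roots [] u). wact (rev u) b \<notin> P)"
proof (induction u rule: rev_induct)
  case (snoc x u)
  let ?b = "wact u (\<alpha> x)"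
  have u: "red u" "x \<in> S" "?b \<in> P" "u \<in> lists S"
    using snoc.prems unfolding red_snoc by (auto simp only: red_def)
  have "wact (rev (u @ [x])) b \<notin> P" if "b \<in> set (roots [] u)" for b
  proof
    assume *: "wact (rev (u @ [x])) b \<in> P"
    have b: "b \<in> P" "wact (rev u) b \<notin> P" using that snoc.IH u unfolding red_def by auto
    then have "- wact (rev u) b \<in> P" using u P_root[OF b(1)] by (simp add: neg_P_iff)
    moreover have "refl x (- wact (rev u) b) \<notin> P"
      using * neg_notin_P by (simp add: reflection_minus)
    ultimately have "- wact (rev u) b = \<alpha> x" using refl_P_cases u by blast
    then have "wact u (wact (rev u) b) = - ?b" by (metis wact_minus minus_minus)
    then show False using u b neg_notin_P by simp
  qed
  moreover have "wact (rev (u @ [x])) ?b \<notin> P" using u neg_notin_P[of "\<alpha> x"] by simp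
  moreover have "?b \<notin> set (roots [] u)" using snoc.IH u by (metis wact_rev_wact simple_P)
  ultimately show ?case using snoc.IH u unfolding roots_snoc by auto
qed simp

text \<open>While the letters are applied one after another, b has to change sign at some letter,
  and at that moment it is the simple root of this letter.\<close>

lemma inversion_in_roots:
  "u \<in> lists S \<Longrightarrow> b \<in> P \<Longrightarrow> wact (rev u) b \<notin> P \<Longrightarrow> b \<in> set (roots [] u)"
proof (induction u arbitrary: b)
  case (Cons y u)
  show ?case
  proof (cases "b = \<alpha> y")
    case False
    have y: "y \<in> S" using Cons.prems by auto
    have "refl y b \<in> P" using False Cons.prems refl_P y by blast
    moreover have "u \<in> lists S" "wact (rev u) (refl y b) \<notin> P" using Cons.prems by auto
    ultimately have "refl y b \<in> set (roots [] u)" using Cons.IH by blast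
    then have "refl y (refl y b) \<in> set (map (refl y) (roots [] u))"
      by (simp only: set_map) (rule imageI)
    moreover have "roots [y] u = map (refl y) (roots [] u)" using roots_prefix[of "[y]" "[]"] by simp
    ultimately have "b \<in> set (roots [y] u)" using y by (metis reflection_reflection simple_nonzero)
    then show ?thesis by simp
  qed simp
qed simp

lemma red_set_roots:
  assumes "red u" shows "set (roots [] u) = {b \<in> P. wact (rev u) b \<notin> P}"
  using red_inversions[OF assms] inversion_in_roots assms unfolding red_def by blast

lemma wact_rev_cong:
  assumes "u \<in> lists S" "u' \<in> lists S" "wact u = wact u'" shows "wact (rev u) = wact (rev u')"
  using assms wact_wact_rev wact_rev_wact by (metis ext)

text \<open>A reduced word lists each inversion of its element exactly once, and any other word for
  that element has to list all of them too.\<close>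

lemma red_minimal:
  assumes "red u" "u' \<in> lists S" "wact u = wact u'" shows "length u \<le> length u'"
proof -
  have u: "u \<in> lists S" using assms unfolding red_def by blast
  have "set (roots [] u) \<subseteq> set (roots [] u')"
    using red_set_roots[OF assms(1)] inversion_in_roots[OF assms(2)]
      wact_rev_cong[OF u assms(2,3)] by auto
  then have "card (set (roots [] u)) \<le> card (set (roots [] u'))" by (simp add: card_mono)
  also have "\<dots> \<le> length u'" using card_length[of "roots [] u'"] by simp
  finally show ?thesis using red_inversions[OF assms(1)] distinct_card[of "roots [] u"] by simp
qed

text \<open>The deletion condition. If u is reduced and \<open>u @ [x]\<close> is not, the negative
  of the new root is an inversion of u, hence the root of some letter y of u; deleting y and x
  leaves the action unchanged.\<close>

lemma not_red_shorten:
  "u \<in> lists S \<Longrightarrow> \<not> red u \<Longrightarrow>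
    \<exists>u'\<in>lists S. length u' < length u \<and> wact u' = wact u"
proof (induction u rule: rev_induct)
  case Nil
  then show ?case by (simp add: red_def)
next
  case (snoc x u)
  have S: "x \<in> S" "u \<in> lists S" using snoc.prems by auto
  show ?case
  proof (cases "red u")
    case False
    then obtain u' where "u' \<in> lists S" "length u' < length u" "wact u' = wact u"
      using snoc S by blast
    then show ?thesis using S by (intro bexI[of _ "u' @ [x]"]) auto
  next
    case True
    let ?b = "wact u (\<alpha> x)"
    have "?b \<notin> P" using True snoc.prems S by (simp add: red_snoc)
    then have "- ?b \<in> P" using S by (simp add: neg_P_iff)
    moreover have "wact (rev u) (- ?b) \<notin> P"
      using S neg_notin_P[of "\<alpha> x"] by (simp add: wact_minus)
    ultimately have "- ?b \<in> set (roots [] u)" using inversion_in_roots S by blast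
    then obtain i where i: "i < length u" "- ?b = wact (take i u) (\<alpha> (u ! i))"
      by (auto simp: in_set_conv_nth nth_lab)
    define A y B where "A = take i u" and "y = u ! i" and "B = drop (Suc i) u"
    have u: "u = A @ y # B" unfolding A_def y_def B_def using i(1) by (simp add: id_take_nth_drop)
    have AB: "A \<in> lists S" "y \<in> S" "B \<in> lists S" using S u by auto
    have "wact A (\<alpha> y) = wact A (- refl y (wact B (\<alpha> x)))"
      using i(2) u unfolding A_def[symmetric] y_def[symmetric] by (simp add: wact_minus)
    then have "\<alpha> y = - refl y (wact B (\<alpha> x))" using AB wact_rev_wact by metis
    then have "refl y (\<alpha> y) = - wact B (\<alpha> x)"
      using AB by (metis reflection_minus reflection_reflection simple_nonzero)
    then have e: "\<alpha> y = wact B (\<alpha> x)" using AB by simp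
    \<comment> \<open>Conjugation by \<open>wact B\<close> turns the reflection x into the
      reflection y, so the two cancel.\<close>
    have "refl y (wact B (refl x v)) = wact B v" for v
    proof -
      have "refl y (wact B (refl x v)) = wact B (refl x (refl x v))"
        unfolding e by (rule reflection_conjugate) (use AB linear_wact in auto)
      then show ?thesis using S by simp
    qed
    then have "wact (A @ B) = wact (u @ [x])" by (intro ext) (simp add: u)
    then show ?thesis using AB u by (intro bexI[of _ "A @ B"]) auto
  qed
qed

lemma ex_red: assumes "u \<in> lists S" shows "\<exists>u'. red u' \<and> wact u' = wact u"
  using assms
proof (induction "length u" arbitrary: u rule: less_induct)
  case less
  then show ?case using not_red_shorten[of u] by (metis (no_types, lifting))
qed

section \<open>Words, reduced or not, for the longest element\<close>

definition longest_word :: "'a list \<Rightarrow> bool" where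
  "longest_word u \<longleftrightarrow> u \<in> lists S \<and> (\<forall>b\<in>P. wact (rev u) b \<notin> P)"

text \<open>One such element composed with the inverse of another changes every sign twice and hence
  preserves \<open>P\<close>. A reduced word for the composite has no inversions, so it is
  empty.\<close>

lemma longest_word_unique:
  assumes "longest_word u" "longest_word u'" shows "wact u = wact u'"
proof -
  have S: "u \<in> lists S" "u' \<in> lists S" using assms unfolding longest_word_def by auto
  have pos: "wact (rev u') (wact u b) \<in> P" if b: "b \<in> P" for b
  proof -
    have "wact u b \<notin> P" using assms(1) b S wact_rev_wact unfolding longest_word_def by metis
    then have "- wact u b \<in> P" using S P_root b by (simp add: neg_P_iff)
    then have "wact (rev u') (- wact u b) \<notin> P" using assms(2) unfolding longest_word_def by blast
    moreover have "wact (rev u') (wact u b) \<in> \<Phi>" using S P_root b by (simp add: in_lists_conv_set)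
    ultimately show ?thesis by (simp add: wact_minus neg_P_iff)
  qed
  obtain v where v: "red v" "wact v = wact (rev u @ u')"
    using ex_red[of "rev u @ u'"] S by auto
  have "wact (rev v) = wact (rev (rev u @ u'))"
    by (rule wact_rev_cong) (use v S in \<open>auto simp: red_def\<close>)
  then have "set (roots [] v) = {}" using red_set_roots[OF v(1)] pos by auto
  then have "v = []" by (cases v) auto
  then have "wact (rev u) (wact u' b) = b" for b using v(2) by (metis wact_simps(1,3))
  then have "wact u b = wact u' b" for b using S by (metis wact_wact_rev)
  then show ?thesis by blast
qed

lemma red_length_le: assumes "red u" shows "length u \<le> card P"
proof -
  have "card (set (roots [] u)) \<le> card P" using assms unfolding red_def by (simp add: card_mono)
  then show ?thesis using red_inversions[OF assms] distinct_card[of "roots [] u"] by simp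
qed

lemma red_longest_iff: assumes "red u" shows "longest_word u \<longleftrightarrow> length u = card P"
proof
  have l: "length u = card (set (roots [] u))"
    using red_inversions[OF assms] distinct_card[of "roots [] u"] by simp
  { assume "longest_word u"
    then have "set (roots [] u) = P"
      using red_set_roots[OF assms] unfolding longest_word_def by blast
    with l show "length u = card P" by simp }
  { assume "length u = card P"
    then have "set (roots [] u) = P"
      using l assms card_subset_eq[of P] unfolding red_def by simp
    then show "longest_word u"
      using red_inversions[OF assms] assms unfolding longest_word_def red_def by simp }
qed

text \<open>The word must list all of \<open>P\<close> among its roots, and \<open>card P\<close>
  letters leave no room for a negative root.\<close>

lemma longest_length_red:
  assumes "longest_word u" "length u = card P" shows "red u" 
proof -
  have S: "u \<in> lists S" using assms unfolding longest_word_def by blast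
  have "P \<subseteq> set (roots [] u)" using assms inversion_in_roots unfolding longest_word_def by blast
  moreover have "card (set (roots [] u)) \<le> card P"
    using assms(2) card_length[of "roots [] u"] by simp
  ultimately have "P = set (roots [] u)" by (simp add: card_seteq)
  then show ?thesis using S unfolding red_def by simp
qed

subsection \<open>Commutation classes of words\<close>

text \<open>Letters carry a label that travels with them when commuting letters are exchanged.\<close>

inductive commeq :: "('a \<times> 'l) list \<Rightarrow> ('a \<times> 'l) list \<Rightarrow> bool" where
  commeq_refl: "commeq L L"
| commeq_swap: "x \<in> S \<Longrightarrow> y \<in> S \<Longrightarrow> \<alpha> x \<bullet> \<alpha> y = 0 \<Longrightarrow>
    commeq (A @ (y, b') # (x, b) # B) L \<Longrightarrow> commeq (A @ (x, b) # (y, b') # B) L"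

lemma commeq_trans: "commeq L M \<Longrightarrow> commeq M N \<Longrightarrow> commeq L N"
  by (induction rule: commeq.induct) (auto intro: commeq_swap)

lemma commeq_sym: "commeq L M \<Longrightarrow> commeq M L"
proof (induction rule: commeq.induct)
  case (commeq_swap x y A b' b B L)
  have "commeq (A @ (y, b') # (x, b) # B) (A @ (x, b) # (y, b') # B)"
    using commeq_swap by (metis commeq.commeq_swap commeq_refl inner_commute)
  then show ?case using commeq_swap.IH commeq_trans by blast
qed (rule commeq_refl)

lemma commeq_context: "commeq L M \<Longrightarrow> commeq (C @ L @ D) (C @ M @ D)"
proof (induction rule: commeq.induct)
  case (commeq_swap x y A b' b B L)
  then show ?case using commeq.commeq_swap[of x y "C @ A" b' b "B @ D"] by simp
qed (rule commeq_refl)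

lemma commeq_Cons: "commeq L M \<Longrightarrow> commeq (a # L) (a # M)"
  using commeq_context[of L M "[a]" "[]"] by simp

lemma commeq_append: "commeq L M \<Longrightarrow> commeq L' M' \<Longrightarrow> commeq (L @ L') (M @ M')"
  using commeq_context[of L M "[]" L'] commeq_context[of L' M' M "[]"] commeq_trans by simp

lemma commeq_filter: "commeq L M \<Longrightarrow> commeq (filter Q L) (filter Q M)"
  by (induction rule: commeq.induct) (auto intro: commeq.intros)

lemma commeq_set: "commeq L M \<Longrightarrow> set L = set M"
  by (induction rule: commeq.induct) auto

lemma commeq_wact: "commeq L M \<Longrightarrow> wact (map fst L) = wact (map fst M)"
proof (induction rule: commeq.induct)
  case (commeq_swap x y A b' b B L)
  then show ?case using reflection_commute[of "\<alpha> x" "\<alpha> y"] by (auto simp: fun_eq_iff)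
qed simp

text \<open>The length \<open>card P\<close> is what makes a word for the longest element reduced.
  In this form the condition refers only to the action of the subword, which commutations
  preserve.\<close>

definition contains_longest :: "'a list \<Rightarrow> bool" where
  "contains_longest w \<longleftrightarrow> (\<exists>u. longest_word u \<and> length u = card P \<and> subseq u w)"

lemma longest_word_cong:
  assumes "u' \<in> lists S" "longest_word u" "wact u = wact u'" shows "longest_word u'"
proof -
  have "u \<in> lists S" using assms unfolding longest_word_def by blast
  then have "wact (rev u) = wact (rev u')" using wact_rev_cong assms by blast
  then show ?thesis using assms unfolding longest_word_def by metis
qed

lemma subseq_append_split:
  "subseq u (v @ w) \<Longrightarrow> \<exists>a b. u = a @ b \<and> subseq a v \<and> subseq b w"
proof (induction v arbitrary: u)
  case Nil
  then show ?case by (intro exI[of _ "[]"] exI[of _ u]) simp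
next
  case (Cons x v)
  show ?case
  proof (cases "\<exists>u'. u = x # u' \<and> subseq u' (v @ w)")
    case True
    then obtain u' a b where "u = x # u'" "u' = a @ b" "subseq a v" "subseq b w"
      using Cons.IH by blast
    then show ?thesis by (intro exI[of _ "x # a"] exI[of _ b]) auto
  next
    case False
    then have "subseq u (v @ w)" using Cons.prems by (cases u) (auto split: if_splits)
    then show ?thesis using Cons.IH by (meson list_emb_Cons)
  qed
qed

text \<open>The chosen subword either uses both letters in succession, and then they are exchanged
  in it as well, or it uses at most one of them and still occurs in the new word.\<close>

lemma contains_longest_swap:
  assumes "x \<in> S" "y \<in> S" "\<alpha> x \<bullet> \<alpha> y = 0" "contains_longest (v @ x # y # w)"
  shows "contains_longest (v @ y # x # w)"
proof -
  obtain u where u: "longest_word u" "length u = card P" "subseq u (v @ x # y # w)"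
    using assms(4) unfolding contains_longest_def by blast
  obtain a b where ab: "u = a @ b" "subseq a v" "subseq b (x # y # w)"
    using subseq_append_split u(3) by blast
  show ?thesis
  proof (cases "\<exists>r. b = x # y # r")
    case True
    then obtain r where r: "b = x # y # r" by blast
    then have "subseq (a @ y # x # r) (v @ y # x # w)"
      using ab by (intro list_emb_append_mono) auto
    moreover have "longest_word (a @ y # x # r)"
      by (rule longest_word_cong[OF _ u(1)])
        (use u(1) ab r reflection_commute[OF assms(3)] in
          \<open>auto simp: longest_word_def fun_eq_iff\<close>)
    ultimately show ?thesis unfolding contains_longest_def using u ab r
      by (intro exI[of _ "a @ y # x # r"]) auto
  next
    case False
    then have "subseq b (y # x # w)" using ab(3)
      by (cases b; cases "tl b") (auto split: if_splits intro: list_emb_Cons dest: subseq_Cons')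
    then have "subseq u (v @ y # x # w)" unfolding ab(1) using ab by (intro list_emb_append_mono)
    then show ?thesis using u unfolding contains_longest_def by blast
  qed
qed

lemma contains_longest_commeq:
  "commeq L M \<Longrightarrow> contains_longest (map fst L) \<longleftrightarrow> contains_longest (map fst M)"
proof (induction rule: commeq.induct)
  case (commeq_swap x y A b' b B L)
  then show ?case
    using contains_longest_swap[of x y] contains_longest_swap[of y x] by (auto simp: inner_commute)
qed simp

lemma commeq_front:
  assumes "A \<in> lists S" "s \<in> S" "\<And>a. a \<in> set A \<Longrightarrow> \<alpha> a \<bullet> \<alpha> s = 0"
  shows "commeq (map (\<lambda>x. (x, h x)) (A @ s # B)) (map (\<lambda>x. (x, h x)) (s # A @ B))"
  using assms
proof (induction A rule: list.induct)
  case (Cons a A)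
  let ?k = "\<lambda>x. (x, h x)"
  have "commeq (map ?k (a # A @ s # B)) (map ?k (a # s # A @ B))"
    using Cons commeq_Cons by simp
  moreover have "commeq (map ?k (a # s # A @ B)) (map ?k (s # a # A @ B))"
    using commeq_swap[of a s "[]" "h s" "h a" "map ?k (A @ B)", OF _ _ _ commeq_refl]
      Cons.prems(1,2) Cons.prems(3)[of a] by simp
  ultimately show ?case using commeq_trans by simp
qed (simp add: commeq_refl)

text \<open>Undoing the common prefix turns orthogonality of the roots of two adjacent letters into
  orthogonality of their simple roots. So a passes the letters of A one by one, starting with the
  last, and no label changes.\<close>

lemma commeq_lab_front:
  assumes "A \<in> lists S" "a \<in> S" "g \<in> lists S"
    and "\<And>b. b \<in> set (roots g A) \<Longrightarrow> b \<bullet> wact (g @ A) (\<alpha> a) = 0"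
  shows "wact A (\<alpha> a) = \<alpha> a \<and> commeq (lab g (A @ a # B)) (lab g (a # A @ B))"
  using assms
proof (induction A arbitrary: B rule: rev_induct)
  case (snoc z A)
  have z: "z \<in> S" "A \<in> lists S" using snoc.prems by auto
  have "wact (g @ A) (\<alpha> z) \<bullet> wact (g @ A) (refl z (\<alpha> a)) = 0"
    using snoc.prems(4)[of "wact (g @ A) (\<alpha> z)"] by (simp add: lab_append)
  then have "\<alpha> z \<bullet> refl z (\<alpha> a) = 0" using z snoc.prems by simp
  then have o: "\<alpha> z \<bullet> \<alpha> a = 0"
    using z by (simp add: reflection_def inner_diff_right inner_commute)
  have za: "refl z (\<alpha> a) = \<alpha> a" "refl a (\<alpha> z) = \<alpha> z"
    using o by (simp_all add: reflection_orthogonal inner_commute)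
  have IH: "wact A (\<alpha> a) = \<alpha> a \<and> commeq (lab g (A @ a # z # B)) (lab g (a # A @ z # B))"
    by (rule snoc.IH) (use snoc.prems z za in \<open>auto simp: lab_append\<close>)
  \<comment> \<open>The labels behind the exchanged pair depend on the prefix only through its
    action.\<close>
  have "lab (g @ A @ [z, a]) B = lab (g @ A @ [a, z]) B"
  proof -
    have "wact (g @ A @ [z, a]) = wact (g @ A @ [a, z])"
      using reflection_commute[OF o] by (auto simp: fun_eq_iff)
    then show ?thesis
      using lab_prefix[of "g @ A @ [z, a]" "[]" B] lab_prefix[of "g @ A @ [a, z]" "[]" B] by simp
  qed
  then have "commeq (lab g (A @ z # a # B)) (lab g (A @ a # z # B))"
    using commeq_swap[OF z(1) snoc.prems(2) o commeq_refl] by (simp add: lab_append za)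
  then show ?case using IH za commeq_trans by auto
qed (simp add: commeq_refl)

text \<open>Z is sorted into Y letter by letter. A root standing before the first root of Y in Z
  stands after it in Y, so the two orders force orthogonality and the letter can be moved to the
  front. The orders R and R' may differ because one of them may be known only in a weaker
  form.\<close>

lemma commeq_lab:
  assumes "g \<in> lists S" "Z \<in> lists S" "Y \<in> lists S"
    and "sorted_wrt R (roots g Z)" "sorted_wrt R' (roots g Y)"
    and "distinct (roots g Z)" "distinct (roots g Y)" "set (roots g Z) = set (roots g Y)"
    and "\<And>b b'. R b b' \<Longrightarrow> R' b' b \<Longrightarrow> b \<bullet> b' = 0"
  shows "commeq (lab g Z) (lab g Y)"
  using assms(1-8)
proof (induction Y arbitrary: g Z)
  case Nil
  then have "Z = []" by (cases Z) auto
  then show ?case by (simp add: commeq_refl)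
next
  case (Cons y Y)
  let ?b = "wact g (\<alpha> y)"
  have "?b \<in> set (roots g Z)" using Cons.prems(8) by simp
  then obtain i where i: "i < length Z" "?b = wact g (wact (take i Z) (\<alpha> (Z ! i)))"
    by (auto simp: in_set_conv_nth nth_lab)
  define A a B where "A = take i Z" and "a = Z ! i" and "B = drop (Suc i) Z"
  have Z: "Z = A @ a # B" unfolding A_def a_def B_def using i(1) by (simp add: id_take_nth_drop)
  have b: "?b = wact (g @ A) (\<alpha> a)" using i(2) unfolding A_def a_def by simp
  have S: "A \<in> lists S" "a \<in> S" "B \<in> lists S" "y \<in> S" "Y \<in> lists S" using Cons.prems Z by auto
  have rZ: "roots g Z = roots g A @ ?b # roots (g @ A @ [a]) B"
    unfolding Z b by (simp add: lab_append)
  have orth: "e \<bullet> wact (g @ A) (\<alpha> a) = 0" if e: "e \<in> set (roots g A)" for e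
  proof -
    have "R e ?b" using Cons.prems(4) e unfolding rZ sorted_wrt_append by (meson list.set_intros(1))
    moreover have "e \<in> set (roots g (y # Y))" using Cons.prems(8) e unfolding rZ by auto
    moreover have "e \<noteq> ?b" using Cons.prems(6) e unfolding rZ distinct_append
      by (metis disjoint_iff list.set_intros(1))
    ultimately have "R e ?b" "R' ?b e" using Cons.prems(5) by auto
    then show ?thesis using assms(9) b by simp
  qed
  have fr: "wact A (\<alpha> a) = \<alpha> a" "commeq (lab g Z) (lab g (a # A @ B))"
    using commeq_lab_front[OF S(1,2) Cons.prems(1) orth] unfolding Z by blast+
  have "\<alpha> a = \<alpha> y" using b fr(1) Cons.prems(1) by (metis wact_rev_wact wact_simps(3))
  then have a: "a = y" using S inj_simple unfolding inj_on_def by blast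
  have wA: "wact (A @ [a]) = wact (a # A)"
  proof
    fix v
    have "refl (a) (wact A v) = wact A (refl a v)"
      using reflection_conjugate[OF linear_wact, of A "\<alpha> a" v] S fr(1) by simp
    then show "wact (A @ [a]) v = wact (a # A) v" by simp
  qed
  have "wact (g @ A @ [a]) = wact (g @ a # A)" using wA by (simp add: fun_eq_iff)
  then have lB: "lab (g @ A @ [a]) B = lab (g @ a # A) B"
    using lab_prefix[of "g @ A @ [a]" "[]" B] lab_prefix[of "g @ a # A" "[]" B] by simp
  have "roots (g @ [y]) (A @ B) = roots (g @ [a]) A @ roots (g @ A @ [a]) B"
    unfolding lB by (simp add: lab_append a)
  \<comment> \<open>The reflection a, now standing in front, fixes the roots of A because they are
    orthogonal to \<open>\<alpha> a\<close>.\<close>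
  moreover have "roots (g @ [a]) A = roots g A"
  proof -
    have "wact [a] e = e" if "e \<in> set (roots [] A)" for e
    proof -
      have "wact g e \<in> set (roots g A)" using roots_prefix[of g "[]" A] that by auto
      from orth[OF this] have "e \<bullet> \<alpha> a = 0" using Cons.prems(1) fr(1) by simp
      then show ?thesis by (simp add: reflection_orthogonal)
    qed
    then have "roots [a] A = roots [] A" using roots_prefix[of "[a]" "[]" A]
      by (metis append_Nil2 map_idI)
    then show ?thesis using roots_prefix[of g "[a]" A] roots_prefix[of g "[]" A] by simp
  qed
  ultimately have rAB: "roots (g @ [y]) (A @ B) = roots g A @ roots (g @ A @ [a]) B" by simp
  have "commeq (lab (g @ [y]) (A @ B)) (lab (g @ [y]) Y)"
  proof (rule Cons.IH)
    show "sorted_wrt R (roots (g @ [y]) (A @ B))" "distinct (roots (g @ [y]) (A @ B))"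
      using Cons.prems(4,6) unfolding rAB rZ by (auto simp: sorted_wrt_append)
    have "set (roots (g @ [y]) (A @ B)) = set (roots g Z) - {?b}"
      using Cons.prems(6) unfolding rAB rZ by auto
    also have "\<dots> = set (roots (g @ [y]) Y)" using Cons.prems(7,8) by auto
    finally show "set (roots (g @ [y]) (A @ B)) = set (roots (g @ [y]) Y)" .
  qed (use Cons.prems S in auto)
  then have "commeq (lab g (a # A @ B)) (lab g (y # Y))" unfolding a by (simp add: commeq_Cons)
  then show ?case using fr(2) commeq_trans by blast
qed

subsection \<open>The skew-symmetric form of a Coxeter word\<close>

text \<open>Each pair of letters s before t contributes the 2 by 2 minor of the coordinates of x and
  y at s and t, weighted by \<open>- (\<alpha> s \<bullet> \<alpha> t)\<close>.\<close>

fun omega :: "'a list \<Rightarrow> 'v \<Rightarrow> 'v \<Rightarrow> real" where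
  "omega [] x y = 0"
| "omega (s # d) x y = omega d x y -
     (\<Sum>t\<leftarrow>d. (\<alpha> s \<bullet> \<alpha> t) * (coord s x * coord t y - coord t x * coord s y))"

lemma omega_snoc: "omega (d @ [s]) x y = omega d x y -
     (\<Sum>t\<leftarrow>d. (\<alpha> t \<bullet> \<alpha> s) * (coord t x * coord s y - coord s x * coord t y))"
  by (induction d) (auto simp: algebra_simps)

lemma omega_minus: "omega d (- x) y = - omega d x y"
proof (induction d)
  case (Cons s d)
  have "(\<Sum>t\<leftarrow>d. (\<alpha> s \<bullet> \<alpha> t) * (- coord s x * coord t y + coord t x * coord s y)) =
    - (\<Sum>t\<leftarrow>d. (\<alpha> s \<bullet> \<alpha> t) * (coord s x * coord t y - coord t x * coord s y))"
    by (induction d) (auto simp: algebra_simps)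
  with Cons show ?case by simp
qed simp

lemma omega_swap: "omega d x y = - omega d y x"
proof (induction d)
  case (Cons s d)
  have "(\<Sum>t\<leftarrow>d. (\<alpha> s \<bullet> \<alpha> t) * (coord s x * coord t y - coord t x * coord s y)) =
    - (\<Sum>t\<leftarrow>d. (\<alpha> s \<bullet> \<alpha> t) * (coord s y * coord t x - coord t y * coord s x))"
    by (induction d) (auto simp: algebra_simps)
  with Cons show ?case by simp
qed simp

lemma omega_cong:
  "(\<And>t. t \<in> set d \<Longrightarrow> coord t x = coord t x' \<and> coord t y = coord t y') \<Longrightarrow>
     omega d x y = omega d x' y'"
proof (induction d)
  case (Cons s d)
  have "map (\<lambda>t. (\<alpha> s \<bullet> \<alpha> t) * (coord s x * coord t y - coord t x * coord s y)) d =
    map (\<lambda>t. (\<alpha> s \<bullet> \<alpha> t) * (coord s x' * coord t y' - coord t x' * coord s y')) d"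
    using Cons.prems by auto
  moreover have "omega d x y = omega d x' y'" using Cons by simp
  ultimately show ?case unfolding omega.simps by (simp only:)
qed simp

lemma omega_0: "(\<And>t. t \<in> set d \<Longrightarrow> coord t x = 0) \<Longrightarrow> omega d x y = 0"
proof (induction d)
  case (Cons s d)
  have "map (\<lambda>t. (\<alpha> s \<bullet> \<alpha> t) * (coord s x * coord t y - coord t x * coord s y)) d =
    map (\<lambda>t. 0) d" using Cons.prems by auto
  moreover have "omega d x y = 0" using Cons by simp
  ultimately show ?case unfolding omega.simps by (simp only:) simp
qed simp

lemma omega_swap_letters:
  assumes "\<alpha> x \<bullet> \<alpha> y = 0" shows "omega (A @ x # y # B) u v = omega (A @ y # x # B) u v"
  using assms by (induction A) (auto simp: inner_commute algebra_simps)

text \<open>Together with \<open>commeq_coxeter_words\<close> this makes the form depend on the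
  Coxeter element only.\<close>

lemma omega_commeq: "commeq L M \<Longrightarrow> omega (map fst L) = omega (map fst M)"
proof (induction rule: commeq.induct)
  case (commeq_swap x y A b' b B L)
  then show ?case using omega_swap_letters[of x y "map fst A" "map fst B"]
    by (simp add: fun_eq_iff)
qed simp

text \<open>Isolates the contribution of s. By \<open>omega_snoc_expand\<close> the same term occurs
  with the opposite sign when s stands at the end.\<close>

lemma omega_Cons_expand:
  "omega (s # d) x y = omega d x y -
     (coord s x * (\<Sum>t\<leftarrow>d. (\<alpha> s \<bullet> \<alpha> t) * coord t y)
      - coord s y * (\<Sum>t\<leftarrow>d. (\<alpha> s \<bullet> \<alpha> t) * coord t x))"
proof -
  have "(\<Sum>t\<leftarrow>d. (\<alpha> s \<bullet> \<alpha> t) * (coord s x * coord t y - coord t x * coord s y)) =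
      coord s x * (\<Sum>t\<leftarrow>d. (\<alpha> s \<bullet> \<alpha> t) * coord t y)
      - coord s y * (\<Sum>t\<leftarrow>d. (\<alpha> s \<bullet> \<alpha> t) * coord t x)"
    by (induction d) (auto simp: algebra_simps)
  then show ?thesis by simp
qed

lemma omega_snoc_expand:
  "omega (d @ [s]) x y = omega d x y +
     (coord s x * (\<Sum>t\<leftarrow>d. (\<alpha> s \<bullet> \<alpha> t) * coord t y)
      - coord s y * (\<Sum>t\<leftarrow>d. (\<alpha> s \<bullet> \<alpha> t) * coord t x))"
proof -
  have "(\<Sum>t\<leftarrow>d. (\<alpha> t \<bullet> \<alpha> s) * (coord t x * coord s y - coord s x * coord t y)) =
      coord s y * (\<Sum>t\<leftarrow>d. (\<alpha> s \<bullet> \<alpha> t) * coord t x)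
      - coord s x * (\<Sum>t\<leftarrow>d. (\<alpha> s \<bullet> \<alpha> t) * coord t y)"
    by (induction d) (auto simp: algebra_simps inner_commute)
  then show ?thesis by (simp add: omega_snoc)
qed

lemma inner_split:
  assumes "distinct (s # d)" "set (s # d) = S" "v \<in> \<Phi>"
  shows "v \<bullet> \<alpha> s = coord s v * (\<alpha> s \<bullet> \<alpha> s) + (\<Sum>t\<leftarrow>d. (\<alpha> s \<bullet> \<alpha> t) * coord t v)"
proof -
  have "v \<bullet> \<alpha> s = (\<Sum>t\<in>S. coord t v * (\<alpha> t \<bullet> \<alpha> s))"
    by (subst root_expand[OF assms(3)]) (simp add: inner_sum_left)
  also have "\<dots> = coord s v * (\<alpha> s \<bullet> \<alpha> s) + (\<Sum>t\<in>set d. coord t v * (\<alpha> t \<bullet> \<alpha> s))"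
    using assms(1,2) by auto
  also have "(\<Sum>t\<in>set d. coord t v * (\<alpha> t \<bullet> \<alpha> s)) = (\<Sum>t\<leftarrow>d. (\<alpha> s \<bullet> \<alpha> t) * coord t v)"
    using assms(1) by (simp add: sum_list_distinct_conv_sum_set inner_commute mult.commute)
  finally show ?thesis .
qed

text \<open>Only the coordinate at s changes: it is negated and shifted by a multiple of the pairing
  of \<open>\<alpha> s\<close> with the other coordinates. The negation compensates the move of s to
  the end, and the shifts contribute a symmetric product that cancels.\<close>

lemma omega_rotate:
  assumes "distinct (s # d)" "set (s # d) = S" "x \<in> \<Phi>" "y \<in> \<Phi>"
  shows "omega (d @ [s]) (refl s x) (refl s y) = omega (s # d) x y"
proof -
  let ?a = "\<lambda>v. \<Sum>t\<leftarrow>d. (\<alpha> s \<bullet> \<alpha> t) * coord t v"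
  have s: "s \<in> S" using assms(2) by (metis list.set_intros(1))
  have co: "coord t (refl s v) = coord t v" if "t \<in> set d" for t v
    using s that assms(1) coord_refl_other[of s t v] by auto
  have a: "?a (refl s v) = ?a v" for v
    by (rule arg_cong[of _ _ sum_list], rule map_cong) (simp_all add: co)
  have o: "omega d (refl s x) (refl s y) = omega d x y"
    by (rule omega_cong) (simp add: co)
  have c: "coord s (refl s v) = - coord s v - 2 * ?a v / (\<alpha> s \<bullet> \<alpha> s)" if "v \<in> \<Phi>" for v
    using inner_split[OF assms(1,2) that] s
    by (simp add: coord_refl_same field_simps)
  show ?thesis unfolding omega_snoc_expand omega_Cons_expand a o c[OF assms(3)] c[OF assms(4)]
    by (simp add: algebra_simps)
qed

text \<open>Distinct simple roots form obtuse or right angles and y has nonnegative coordinates. If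
  the sum vanishes, reflecting in s negates the coordinate at s; the reflected root is positive as
  well, so this coordinate is zero and orthogonality follows.\<close>

lemma simple_pairing_nonpos:
  assumes "distinct (s # d)" "set (s # d) = S" "y \<in> P"
  shows "(\<Sum>t\<leftarrow>d. (\<alpha> s \<bullet> \<alpha> t) * coord t y) \<le> 0"
    and "(\<Sum>t\<leftarrow>d. (\<alpha> s \<bullet> \<alpha> t) * coord t y) = 0 \<Longrightarrow> y \<noteq> \<alpha> s \<Longrightarrow> \<alpha> s \<bullet> y = 0"
proof -
  have s: "s \<in> S" "s \<notin> set d" "set d \<subseteq> S" using assms by auto
  let ?f = "\<lambda>t. (\<alpha> s \<bullet> \<alpha> t) * coord t y"
  have le: "?f t \<le> 0" if "t \<in> set d" for t
    using inner_simple_le[of s t] that s assms(3)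
    by (intro mult_nonpos_nonneg) (auto simp: P_iff)
  show *: "(\<Sum>t\<leftarrow>d. ?f t) \<le> 0" by (rule sum_list_nonpos) (use le in auto)
  assume z: "(\<Sum>t\<leftarrow>d. ?f t) = 0" and y: "y \<noteq> \<alpha> s"
  have yr: "y \<in> \<Phi>" using assms P_root by blast
  have i: "y \<bullet> \<alpha> s = coord s y * (\<alpha> s \<bullet> \<alpha> s)" using inner_split[OF assms(1,2) yr] z by simp
  have "coord s (refl s y) = - coord s y" using s i by (simp add: coord_refl_same)
  moreover have "refl s y \<in> P" using refl_P assms(3) s y by blast
  ultimately have "coord s y = 0" using assms(3) s by (force simp: P_iff)
  then show "\<alpha> s \<bullet> y = 0" using i by (simp add: inner_commute)
qed

text \<open>With \<open>\<alpha> s\<close> as an argument only the pairs involving s contribute, and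
  the form becomes the negative of the sum in \<open>simple_pairing_nonpos\<close>.\<close>

lemma omega_initial:
  assumes "distinct (s # d)" "set (s # d) = S" "y \<in> P"
  shows "0 \<le> omega (s # d) (\<alpha> s) y"
    and "omega (s # d) (\<alpha> s) y = 0 \<Longrightarrow> y \<noteq> \<alpha> s \<Longrightarrow> \<alpha> s \<bullet> y = 0"
proof -
  have s: "s \<in> S" using assms(2) by (metis list.set_intros(1))
  have s0: "coord t (\<alpha> s) = 0" if "t \<in> set d" for t using s that assms(1) by auto
  have m: "map (\<lambda>t. (\<alpha> s \<bullet> \<alpha> t) * coord t (\<alpha> s)) d = map (\<lambda>t. 0) d" using s0 by simp
  have z: "(\<Sum>t\<leftarrow>d. (\<alpha> s \<bullet> \<alpha> t) * coord t (\<alpha> s)) = 0" unfolding m by simp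
  have "omega (s # d) (\<alpha> s) y = - (\<Sum>t\<leftarrow>d. (\<alpha> s \<bullet> \<alpha> t) * coord t y)"
    using s s0 omega_0[of d "\<alpha> s" y] unfolding omega_Cons_expand z by simp
  then show "0 \<le> omega (s # d) (\<alpha> s) y"
    "omega (s # d) (\<alpha> s) y = 0 \<Longrightarrow> y \<noteq> \<alpha> s \<Longrightarrow> \<alpha> s \<bullet> y = 0"
    using simple_pairing_nonpos[OF assms] by auto
qed

lemma omega_final:
  assumes "distinct (s # d)" "set (s # d) = S" "y \<in> P"
  shows "0 \<le> omega (d @ [s]) y (\<alpha> s)"
proof -
  have s: "s \<in> S" using assms(2) by (metis list.set_intros(1))
  have s0: "coord t (\<alpha> s) = 0" if "t \<in> set d" for t using s that assms(1) by auto
  have m: "map (\<lambda>t. (\<alpha> s \<bullet> \<alpha> t) * coord t (\<alpha> s)) d = map (\<lambda>t. 0) d" using s0 by simp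
  have z: "(\<Sum>t\<leftarrow>d. (\<alpha> s \<bullet> \<alpha> t) * coord t (\<alpha> s)) = 0" unfolding m by simp
  have "omega (d @ [s]) y (\<alpha> s) = - (\<Sum>t\<leftarrow>d. (\<alpha> s \<bullet> \<alpha> t) * coord t y)"
    using s s0 omega_0[of d "\<alpha> s" y] omega_swap[of d y "\<alpha> s"] unfolding omega_snoc_expand z by simp
  then show ?thesis using simple_pairing_nonpos(1)[OF assms] by simp
qed

section \<open>Initial letters and commutations of Coxeter words\<close>

lemma wact_fixed_orthogonal:
  assumes "u \<in> lists S" "distinct u" "wact u v = v" "y \<in> set u"
  shows "v \<bullet> \<alpha> y = 0"
  using assms
proof (induction u rule: list.induct)
  case (Cons x u)
  have x: "x \<in> S" "u \<in> lists S" using Cons.prems(1) by simp_all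
  have e: "wact u v = refl x v"
    using Cons.prems(3) x by (metis reflection_reflection simple_nonzero wact_simps(2))
  \<comment> \<open>As x does not occur again, it alone could change the coordinate at x of the
    fixed vector; since that coordinate is unchanged, x fixes the vector and can be peeled
    off.\<close>
  have "coord x (wact u v) = coord x v" using Cons.prems(2) x by (simp add: coord_wact_other)
  then have o: "v \<bullet> \<alpha> x = 0" using x unfolding e by (simp add: coord_refl_same)
  then have "wact u v = v" unfolding e by (rule reflection_orthogonal)
  then show ?case using Cons o by auto
qed simp

text \<open>The letters of A carry \<open>\<alpha> s\<close> to a positive root. What follows does
  not touch its coordinates at letters of A but ends in a negative root, so these coordinates
  vanish. Hence A fixes \<open>\<alpha> s\<close>, and distinctness of its letters gives
  orthogonality.\<close>

lemma initial_orthogonal: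
  assumes "A @ s # B \<in> lists S" "distinct (A @ s # B)"
    and "wact (rev (A @ s # B)) (\<alpha> s) \<notin> P" "y \<in> set A"
  shows "\<alpha> y \<bullet> \<alpha> s = 0"
proof -
  have S: "A \<in> lists S" "B \<in> lists S" "s \<in> S" and s: "s \<notin> set A" using assms by auto
  let ?v = "wact (rev A) (\<alpha> s)"
  let ?w = "wact (rev B) (refl s ?v)"
  have v: "?v \<in> \<Phi>" using S by simp
  have c1: "coord s ?v = 1" using S s by (simp add: coord_wact_other)
  then have vP: "?v \<in> P" using pos_coord_P[OF v S(3)] by simp
  have w: "?w \<in> \<Phi>" "?w \<notin> P" using S v assms(3) by auto
  have "coord a ?v = 0" if a: "a \<in> set A" for a
  proof -
    have "coord a ?w = coord a ?v"
      using S a assms(2) coord_wact_other[of "rev B" a "refl s ?v"] coord_refl_other[of s a ?v]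
      by (metis disjoint_insert(1) distinct_append insert_absorb list.simps(15) rev_in_lists set_rev)
    moreover have "a \<in> S" using S a by auto
    ultimately show ?thesis using w vP pos_coord_P[of ?w a] by (force simp: P_iff)
  qed
  then have "coord t ?v = (if t = s then 1 else 0)" if "t \<in> S" for t
    using c1 S that by (cases "t \<in> set A") (auto simp: coord_wact_other)
  then have "coord t ?v *\<^sub>R \<alpha> t = (if t = s then \<alpha> s else 0)" if "t \<in> S" for t using that by simp
  then have "?v = (\<Sum>t\<in>S. if t = s then \<alpha> s else 0)"
    using root_expand[OF v] sum.cong[of S S] by simp
  then have "?v = \<alpha> s" using S(3) by simp
  then show ?thesis
    using wact_fixed_orthogonal[of "rev A" "\<alpha> s" y] S assms by (simp add: inner_commute)
qed

text \<open>The first letter of d is initial in the element of d' as well, so it commutes with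
  everything before it in d', can be moved to the front and cancelled.\<close>

lemma commeq_coxeter_words:
  assumes "d \<in> lists S" "distinct d" "distinct d'" "set d = set d'" "wact d = wact d'"
  shows "commeq (map (\<lambda>x. (x, h x)) d) (map (\<lambda>x. (x, h x)) d')"
  using assms
proof (induction d arbitrary: d' rule: list.induct)
  case Nil
  then show ?case by (simp add: commeq_refl)
next
  case (Cons s d)
  have "s \<in> set d'" using Cons.prems by auto
  then obtain A B where d': "d' = A @ s # B" by (meson split_list)
  have S: "s \<in> S" "d \<in> lists S" using Cons.prems(1) by simp_all
  have S': "d' \<in> lists S" using Cons.prems(1,4) by (metis in_lists_conv_set)
  then have S'': "A \<in> lists S" "B \<in> lists S" using d' by simp_all
  have "wact (rev d') = wact (rev (s # d))" using wact_rev_cong[OF S' Cons.prems(1)] Cons.prems(5) by simp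
  then have w: "wact (rev d') (\<alpha> s) = - wact (rev d) (\<alpha> s)" using S by (simp add: wact_minus)
  \<comment> \<open>Since s is not in d, the rest of the word keeps the coordinate at s; its value
    -1 certifies a negative root.\<close>
  have "coord s (wact (rev d') (\<alpha> s)) = - 1"
    unfolding w using Cons.prems S by (simp add: coord_wact_other)
  then have "wact (rev d') (\<alpha> s) \<notin> P" using S by (force simp: P_iff)
  then have o: "\<And>y. y \<in> set A \<Longrightarrow> \<alpha> y \<bullet> \<alpha> s = 0"
    using initial_orthogonal[of A s B] S' Cons.prems(3) d' by blast
  let ?m = "map (\<lambda>x. (x, h x))"
  have c: "commeq (?m d') (?m (s # A @ B))" unfolding d' by (rule commeq_front) (use S S'' o in auto)
  have "wact d' = wact (s # A @ B)" using commeq_wact[OF c] by (simp add: comp_def)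
  then have "refl s (wact d v) = refl s (wact (A @ B) v)" for v using Cons.prems by (metis wact_simps(2))
  then have "wact d v = wact (A @ B) v" for v using S by (metis reflection_reflection simple_nonzero)
  then have "wact d = wact (A @ B)" by blast
  moreover have "set d = set (A @ B)" using Cons.prems d' by auto
  moreover have "distinct d" "distinct (A @ B)" using Cons.prems(2,3) d' by auto
  ultimately have "commeq (?m d) (?m (A @ B))" using Cons.IH S by blast
  then have "commeq (?m (s # d)) (?m (s # A @ B))" using commeq_Cons by simp
  then show ?case using c commeq_sym commeq_trans by blast
qed

end

subsection \<open>The greedy word of a Coxeter word\<close>

locale coxeter_word = root_basis S \<alpha> \<Phi>
  for S :: "'a set" and \<alpha> :: "'a \<Rightarrow> 'v::euclidean_space" and \<Phi> :: "'v set" +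
  fixes d :: "'a list"
  assumes distinct_d: "distinct d" and set_d: "set d = S" and d_nonempty: "d \<noteq> []"
begin

definition letter :: "nat \<Rightarrow> 'a" where "letter p = d ! (p mod length d)"

lemma letter_S [simp]: "letter p \<in> S"
  unfolding letter_def set_d[symmetric] using d_nonempty by simp

lemma map_letter_S [simp]: "map letter ps \<in> lists S"
  by (auto simp: in_lists_conv_set)

text \<open>The inverse of the product of the first p letters of the infinite word: letters are
  applied in reading order.\<close>

definition pull :: "nat \<Rightarrow> 'v \<Rightarrow> 'v" where
  "pull p = wact (rev (map letter [0..<p]))"

lemma pull_0 [simp]: "pull 0 v = v"
  and pull_Suc [simp]: "pull (Suc p) v = refl (letter p) (pull p v)"
  by (simp_all add: pull_def)

lemma pull_root [simp]: "b \<in> \<Phi> \<Longrightarrow> pull p b \<in> \<Phi>"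
  by (simp add: pull_def)

lemma inner_pull [simp]: "pull p u \<bullet> pull p v = u \<bullet> v"
  by (simp add: pull_def)

lemma pull_minus: "pull p (- v) = - pull p v"
  by (simp add: pull_def wact_minus)

lemma ex_pull: assumes "b \<in> \<Phi>" shows "\<exists>e\<in>\<Phi>. pull p e = b"
  unfolding pull_def using assms map_letter_S by (metis wact_root wact_rev_wact)

lemma inj_pull: "pull p u = pull p v \<Longrightarrow> u = v"
  unfolding pull_def using wact_wact_rev[of "map letter [0..<p]"] map_letter_S by metis

lemma rotate_split: "rotate p d = letter p # tl (rotate p d)"
  using d_nonempty hd_rotate_conv_nth[OF d_nonempty, of p] unfolding letter_def
  by (metis list.collapse rotate_is_Nil_conv)

lemma rotate_coxeter:
  "distinct (letter p # tl (rotate p d))" "set (letter p # tl (rotate p d)) = S"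
  unfolding rotate_split[symmetric] using distinct_d set_d by simp_all

text \<open>Iterates \<open>omega_rotate\<close>: after p letters the rotated word starts with the
  next letter to be applied, so that letter is always initial.\<close>

lemma omega_pull:
  assumes "x \<in> \<Phi>" "y \<in> \<Phi>"
  shows "omega (rotate p d) (pull p x) (pull p y) = omega d x y"
proof (induction p)
  case (Suc p)
  have "rotate (Suc p) d = tl (rotate p d) @ [letter p]"
    using rotate_split[of p] by (metis rotate1.simps(2) rotate_Suc)
  then show ?case
    using omega_rotate[OF rotate_coxeter[of p], of "pull p x" "pull p y"] assms Suc
      rotate_split[of p] by simp
qed simp

lemma omega_letter:
  assumes "e \<in> P" shows "0 \<le> omega (rotate p d) (\<alpha> (letter p)) e"
    "omega (rotate p d) (\<alpha> (letter p)) e = 0 \<Longrightarrow> e \<noteq> \<alpha> (letter p) \<Longrightarrow> \<alpha> (letter p) \<bullet> e = 0"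
  using omega_initial[OF rotate_coxeter[of p] assms] rotate_split[of p] by simp_all

text \<open>The whole history is recorded, so a root that becomes positive again after dying still
  counts as dead.\<close>

definition alive :: "nat \<Rightarrow> 'v \<Rightarrow> bool" where
  "alive p b \<longleftrightarrow> (\<forall>q\<le>p. pull q b \<in> P)"

lemma alive_0 [simp]: "alive 0 b \<longleftrightarrow> b \<in> P"
  by (simp add: alive_def)

lemma alive_Suc: "alive (Suc p) b \<longleftrightarrow> alive p b \<and> pull (Suc p) b \<in> P"
  by (auto simp: alive_def le_Suc_eq)

lemma alive_mono: "alive p b \<Longrightarrow> q \<le> p \<Longrightarrow> alive q b"
  by (auto simp: alive_def)

lemma alive_pull: "alive p b \<Longrightarrow> pull p b \<in> P"
  by (auto simp: alive_def)

lemma alive_P: "alive p b \<Longrightarrow> b \<in> P"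
  using alive_mono[of p b 0] by simp

lemma dying: assumes "alive p b" "\<not> alive (Suc p) b" shows "pull p b = \<alpha> (letter p)"
  using refl_P_cases[of "pull p b" "letter p"] assms alive_pull by (simp add: alive_Suc)

text \<open>At the step where b dies it has been pulled to the simple root of the current, initial
  letter, while e has been pulled to another positive root. There \<open>omega_initial\<close>
  applies, and form and inner product are invariant under pulling.\<close>

lemma omega_dead_alive:
  assumes "b \<in> P" "\<not> alive p b" "alive p e"
  shows "0 \<le> omega d b e \<and> (omega d b e = 0 \<longrightarrow> b \<bullet> e = 0)"
  using assms(2,3)
proof (induction p)
  case 0
  then show ?case using assms(1) by simp
next
  case (Suc p)
  show ?case
  proof (cases "alive p b")
    case True
    have e: "alive p e" using Suc.prems by (simp add: alive_Suc)
    have x: "pull p b = \<alpha> (letter p)" using dying True Suc.prems by blast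
    have "pull p e \<noteq> pull p b" using inj_pull Suc.prems by metis
    then show ?thesis
      using omega_letter[OF alive_pull[OF e], of p] omega_pull[of b e p] assms(1) P_root alive_P[OF e]
        inner_pull[of p b e] unfolding x by auto
  next
    case False
    then show ?thesis using Suc by (simp add: alive_Suc)
  qed
qed

text \<open>At the moment of a return to \<open>P\<close>, the negative of the root is the initial simple root, which
  pairs nonnegatively with every root still alive.\<close>

lemma dead_stays_negative:
  assumes "b \<in> P" "\<not> alive p b" "alive p e" "omega d b e > 0"
  shows "pull p b \<notin> P"
  using assms(2,3)
proof (induction p)
  case 0
  then show ?case using assms(1) by simp
next
  case (Suc p)
  show ?case
  proof (cases "alive p b")
    case True
    then show ?thesis using Suc.prems by (simp add: alive_Suc)
  next
    case False
    have e: "alive p e" using Suc.prems by (simp add: alive_Suc)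
    have r: "b \<in> \<Phi>" "e \<in> \<Phi>" using assms(1) alive_P[OF e] P_root by auto
    have n: "- pull p b \<in> P" using Suc False e r by (simp add: neg_P_iff)
    show ?thesis
    proof
      assume "pull (Suc p) b \<in> P"
      then have "refl (letter p) (- pull p b) \<notin> P"
        using neg_notin_P by (simp add: reflection_minus)
      then have "\<alpha> (letter p) = pull p (- b)"
        using refl_P_cases[OF n] by (metis letter_S pull_minus)
      then have "0 \<le> omega d (- b) e"
        using omega_letter(1)[OF alive_pull[OF e], of p] omega_pull[of "- b" e p] r neg_root by simp
      then show False using assms(4) by (simp add: omega_minus)
    qed
  qed
qed

section \<open>The greedy subword, its roots and its minimality\<close>

primrec greedy :: "nat \<Rightarrow> nat list" where
  "greedy 0 = []"
| "greedy (Suc p) =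
    (if wact (map letter (greedy p)) (\<alpha> (letter p)) \<in> P then greedy p @ [p] else greedy p)"

text \<open>On living roots the greedy subword acts like the full prefix although letters have been
  skipped. This holds because a skipped reflection fixes every pulled living root; when a letter is
  taken, only the sign of its own simple root is at stake.\<close>

lemma greedy_invariant:
  "(\<forall>e. alive p e \<longrightarrow> wact (rev (map letter (greedy p))) e = pull p e) \<and>
   (\<forall>b\<in>P. \<not> alive p b \<longrightarrow> wact (rev (map letter (greedy p))) b \<notin> P)"
proof (induction p)
  case (Suc p)
  let ?w = "map letter (greedy p)" and ?x = "letter p"
  let ?b = "wact ?w (\<alpha> ?x)"
  have IH1: "\<And>e. alive p e \<Longrightarrow> wact (rev ?w) e = pull p e"
    and IH2: "\<And>b. b \<in> P \<Longrightarrow> \<not> alive p b \<Longrightarrow> wact (rev ?w) b \<notin> P"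
    using Suc by auto
  have w [simp]: "?w \<in> lists S" by simp
  have b: "wact (rev ?w) ?b = \<alpha> ?x" using wact_rev_wact[OF w] by simp
  show ?case
  proof (cases "?b \<in> P")
    case True
    have W: "wact (rev (map letter (greedy (Suc p)))) v = refl ?x (wact (rev ?w) v)" for v
      using True by simp
    have "wact (rev (map letter (greedy (Suc p)))) e \<notin> P" if e: "e \<in> P" "\<not> alive (Suc p) e" for e
    proof (cases "alive p e")
      case True
      then have "wact (rev ?w) e = \<alpha> ?x" using IH1 dying e by simp
      then show ?thesis unfolding W using neg_notin_P[of "\<alpha> ?x"] by simp
    next
      case False
      have "wact (rev ?w) e \<in> \<Phi>" using e P_root wact_root[of "rev ?w"] by simp
      then have n: "- wact (rev ?w) e \<in> P" using IH2 e False by (simp add: neg_P_iff)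
      have "- wact (rev ?w) e \<noteq> \<alpha> ?x"
      proof
        assume "- wact (rev ?w) e = \<alpha> ?x"
        then have "wact ?w (wact (rev ?w) e) = - ?b" by (metis minus_minus wact_minus)
        then show False using wact_wact_rev[OF w] e True neg_notin_P by simp
      qed
      then have "refl ?x (- wact (rev ?w) e) \<in> P" using refl_P n by simp
      then show ?thesis unfolding W using neg_notin_P by (fastforce simp: reflection_minus)
    qed
    moreover have "wact (rev (map letter (greedy (Suc p)))) e = pull (Suc p) e"
      if "alive (Suc p) e" for e
      unfolding W using IH1 that by (simp add: alive_Suc)
    ultimately show ?thesis by blast
  next
    case False
    have orth: "\<alpha> ?x \<bullet> pull p e = 0" if e: "alive p e" for e
    proof -
      \<comment> \<open>The simple root of the skipped letter is traced back to the start of the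
        word, and b is the positive one of c and its negative.\<close>
      obtain c where c: "c \<in> \<Phi>" "pull p c = \<alpha> ?x" using ex_pull[of "\<alpha> ?x" p] by auto
      obtain b where b': "b \<in> P" "b = c \<or> b = - c" using root_cases[OF c(1)] by auto
      \<comment> \<open>Were b alive, the greedy subword would also pull it to this simple root, b
        would be the root of the letter, and the letter would have been taken.\<close>
      have dead: "\<not> alive p b"
      proof
        assume a: "alive p b"
        then have "pull p b = \<alpha> ?x"
          using alive_pull[OF a] b' c neg_notin_P[of "\<alpha> ?x"] by (auto simp: pull_minus)
        then have "wact (rev ?w) b = \<alpha> ?x" using IH1 a by simp
        then have "?b = b" using wact_wact_rev[OF w] by metis
        then show False using False b' by simp
      qed
      have r: "b \<in> \<Phi>" "e \<in> \<Phi>" using b' e alive_P P_root by auto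
      have o: "0 \<le> omega d b e" "omega d b e = 0 \<Longrightarrow> b \<bullet> e = 0"
        using omega_dead_alive[OF b'(1) dead e] by auto
      \<comment> \<open>A positive pairing keeps b negative after its death, so the simple root is
        the pull of \<open>- b\<close>. Being initial, it pairs nonnegatively with the pull of e,
        which contradicts the sign.\<close>
      have "\<not> omega d b e > 0"
      proof
        assume g: "omega d b e > 0"
        then have "pull p b \<notin> P" using dead_stays_negative b' dead e by blast
        then have "b = - c" using b' c by auto
        then have "\<alpha> ?x = pull p (- b)" using c by simp
        then have "0 \<le> omega d (- b) e"
          using omega_letter(1)[OF alive_pull[OF e], of p] omega_pull[of "- b" e p] r neg_root by simp
        then show False using g by (simp add: omega_minus)
      qed
      then have "c \<bullet> e = 0" using o b' by auto
      then show ?thesis using inner_pull[of p c e] c by simp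
    qed
    then have fixed: "pull (Suc p) e = pull p e" if "alive p e" for e
      using that by (simp add: reflection_orthogonal inner_commute)
    then have "alive (Suc p) e \<longleftrightarrow> alive p e" for e using alive_pull by (auto simp: alive_Suc)
    moreover have "greedy (Suc p) = greedy p" using False by simp
    ultimately show ?thesis using IH1 IH2 fixed by metis
  qed
qed simp

lemma pull_period: "pull (length d * j + length d) v = wact (rev d) (pull (length d * j) v)"
proof -
  let ?n = "length d"
  have "map letter [?n * j..<?n * j + ?n] = d"
    by (rule nth_equalityI) (simp_all add: letter_def)
  moreover have "[0..<?n * j + ?n] = [0..<?n * j] @ [?n * j..<?n * j + ?n]"
    by (rule upt_add_eq_append) simp
  ultimately show ?thesis unfolding pull_def by simp
qed

text \<open>The sum over the orbit of a root under the Coxeter element is a fixed vector of it, hence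
  vanishes; so the orbit of a positive root contains a negative root.\<close>

lemma eventually_dead: assumes "b \<in> \<Phi>" shows "\<exists>p. \<not> alive p b"
proof (rule ccontr)
  assume "\<nexists>p. \<not> alive p b"
  then have pos: "pull p b \<in> P" for p using alive_pull by blast
  let ?n = "length d" and ?C = "wact (rev d)"
  have d: "d \<in> lists S" using set_d by auto
  define Orb where "Orb = range (\<lambda>j. pull (?n * j) b)"
  have OP: "Orb \<subseteq> P" unfolding Orb_def using pos by auto
  then have fin: "finite Orb" using finite_subset finite_P by blast
  have "?C (pull (?n * j) b) \<in> Orb" for j
    unfolding Orb_def by (rule range_eqI[of _ _ "Suc j"]) (simp add: pull_period[symmetric] add.commute)
  then have "?C ` Orb \<subseteq> Orb" unfolding Orb_def by blast
  moreover have inj: "inj_on ?C Orb" using d by (metis inj_onI wact_wact_rev)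
  ultimately have img: "?C ` Orb = Orb" using endo_inj_surj[OF fin] by blast
  define v where "v = \<Sum>Orb"
  have "?C v = (\<Sum>e\<in>Orb. ?C e)" unfolding v_def by (simp add: linear_sum[OF linear_wact])
  also have "\<dots> = \<Sum>(?C ` Orb)" using inj by (simp add: sum.reindex)
  finally have fixed: "?C v = v" unfolding img v_def .
  have orth: "v \<bullet> \<alpha> t = 0" if "t \<in> S" for t
    using wact_fixed_orthogonal[of "rev d" v t] d fixed distinct_d set_d that by simp
  have "v \<bullet> e = 0" if "e \<in> Orb" for e
  proof -
    have "v \<bullet> e = v \<bullet> (\<Sum>t\<in>S. coord t e *\<^sub>R \<alpha> t)" using root_expand[of e] that OP P_root by auto
    also have "\<dots> = 0" using orth by (simp add: inner_sum_right)
    finally show ?thesis .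
  qed
  then have "v \<bullet> v = 0" by (subst (2) v_def) (simp add: inner_sum_right)
  then have v0: "v = 0" by simp
  have bO: "b \<in> Orb" unfolding Orb_def by (rule range_eqI[of _ _ 0]) simp
  have "coord t b = 0" if t: "t \<in> S" for t
  proof -
    have "(\<Sum>e\<in>Orb. coord t e) = coord t v" unfolding v_def by (simp add: linear_sum[OF linear_coord])
    then have "(\<Sum>e\<in>Orb. coord t e) = 0" using v0 linear_0[OF linear_coord] by simp
    moreover have "\<And>e. e \<in> Orb \<Longrightarrow> 0 \<le> coord t e" using OP t P_iff by blast
    ultimately show ?thesis using sum_nonneg_eq_0_iff[OF fin] bO by blast
  qed
  then show False using root_eq_0 assms by blast
qed

lemma ex_all_dead: "\<exists>p. \<forall>b\<in>P. \<not> alive p b"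
proof -
  have "\<forall>b\<in>P. \<exists>p. \<not> alive p b" using eventually_dead P_root by blast
  then obtain f where f: "\<And>b. b \<in> P \<Longrightarrow> \<not> alive (f b) b" by metis
  have "\<not> alive (Max (f ` P)) b" if "b \<in> P" for b
    using f[OF that] alive_mono[of "Max (f ` P)" b "f b"] that by auto
  then show ?thesis by blast
qed

lemma greedy_red: "red (map letter (greedy p))"
proof (induction p)
  case 0
  then show ?case by (simp add: red_def)
qed (simp add: red_snoc)

text \<open>Ensures that the sorting word of s d begins with s, the letter that the rotation
  consumes together with the s of the Coxeter word.\<close>

lemma greedy_Suc_Cons: "\<exists>r. greedy (Suc p) = 0 # r"
proof (induction p)
  case (Suc p)
  then obtain r where r: "greedy (Suc p) = 0 # r" by blast
  have "\<exists>v. greedy (Suc (Suc p)) = greedy (Suc p) @ v"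
    by (cases "greedy (Suc (Suc p)) = greedy (Suc p)") (auto split: if_splits)
  then show ?case unfolding r by auto
qed simp

lemma greedy_sorted: "sorted_wrt (<) (greedy p) \<and> (\<forall>i\<in>set (greedy p). i < p)"
  by (induction p) (auto simp: sorted_wrt_append less_Suc_eq)

text \<open>The root of a letter taken at position p is alive at p and dies in that very step. All
  earlier roots of the subword are dead by then, so \<open>omega_dead_alive\<close> compares them
  with it.\<close>

lemma greedy_roots:
  "(\<forall>b\<in>set (roots [] (map letter (greedy p))). \<not> alive p b) \<and>
   sorted_wrt (\<lambda>b e. 0 \<le> omega d b e \<and> (omega d b e = 0 \<longrightarrow> b \<bullet> e = 0))
     (roots [] (map letter (greedy p)))"
proof (induction p)
  case (Suc p)
  let ?w = "map letter (greedy p)"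
  let ?b = "wact ?w (\<alpha> (letter p))"
  show ?case
  proof (cases "?b \<in> P")
    case True
    have r: "roots [] (map letter (greedy (Suc p))) = roots [] ?w @ [?b]"
      using True by (simp add: lab_append)
    have wb: "wact (rev ?w) ?b = \<alpha> (letter p)" using wact_rev_wact[of ?w] by simp
    \<comment> \<open>By the invariant a dead root would be sent to a negative root, but this one is
      sent to a simple root.\<close>
    then have a: "alive p ?b" using greedy_invariant[of p] True simple_P[of "letter p"] letter_S by metis
    have "pull p ?b = \<alpha> (letter p)" using greedy_invariant[of p] a wb by metis
    then have "\<not> alive (Suc p) ?b" using neg_notin_P[of "\<alpha> (letter p)"] by (simp add: alive_Suc)
    moreover have "0 \<le> omega d e ?b \<and> (omega d e ?b = 0 \<longrightarrow> e \<bullet> ?b = 0)"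
      if "e \<in> set (roots [] ?w)" for e
      using omega_dead_alive[OF _ _ a] Suc that greedy_red[of p] unfolding red_def by blast
    ultimately show ?thesis unfolding r using Suc by (auto simp: sorted_wrt_append alive_Suc)
  next
    case False
    then show ?thesis using Suc by (auto simp: alive_Suc)
  qed
qed simp

text \<open>Prefixes of reduced words are reduced, so a reduced sequence that agrees with the greedy
  one so far cannot take a position that the greedy one skips. The first difference is thus a
  position a that the greedy sequence takes and qs passes over; w may be empty.\<close>

lemma greedy_least:
  assumes "sorted_wrt (<) qs" "red (map letter qs)"
  shows "(\<exists>w. qs = greedy p @ w \<and> (\<forall>b\<in>set w. p \<le> b)) \<or>
    (\<exists>u a v w. greedy p = u @ a # v \<and> qs = u @ w \<and> (\<forall>b\<in>set w. a < b))"
proof (induction p)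
  case (Suc p)
  show ?case
  proof (cases "\<exists>w. qs = greedy p @ w \<and> (\<forall>b\<in>set w. p \<le> b)")
    case True
    then obtain w where w: "qs = greedy p @ w" "\<forall>b\<in>set w. p \<le> b" by blast
    show ?thesis
    proof (cases "\<exists>w'. w = p # w'")
      case True
      then obtain w' where w': "w = p # w'" by blast
      have "red (map letter (greedy p) @ [letter p])"
        using assms(2) unfolding w(1) w' red_def by (auto simp: lab_append)
      then have "greedy (Suc p) = greedy p @ [p]" by (simp add: red_snoc)
      moreover have "\<forall>b\<in>set w'. Suc p \<le> b"
        using assms(1) unfolding w(1) w' by (auto simp: sorted_wrt_append)
      ultimately show ?thesis using w(1) w' by simp
    next
      case False
      have lt: "\<forall>b\<in>set w. p < b"
      proof (cases w)
        case (Cons a r)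
        then have "p < a" using w(2) False by (simp add: le_neq_implies_less)
        moreover have "\<forall>b\<in>set r. a < b" using assms(1) unfolding w(1) Cons
          by (auto simp: sorted_wrt_append)
        ultimately show ?thesis unfolding Cons by auto
      qed simp
      show ?thesis
      proof (cases "greedy (Suc p) = greedy p")
        case True
        then show ?thesis using w lt by auto
      next
        case False
        then have "greedy (Suc p) = greedy p @ p # []" by (auto split: if_splits)
        then show ?thesis using w(1) lt by blast
      qed
    qed
  next
    case False
    then obtain u a v w where *: "greedy p = u @ a # v" "qs = u @ w" "\<forall>b\<in>set w. a < b"
      using Suc by blast
    have "\<exists>v'. greedy (Suc p) = u @ a # v'" using *(1) by simp
    then show ?thesis using * by blast
  qed
qed simp

lemma greedy_lexord:
  assumes "sorted_wrt (<) qs" "red (map letter qs)" "length qs = length (greedy p)"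
  shows "greedy p = qs \<or> (greedy p, qs) \<in> lexord less_than"
  using greedy_least[OF assms(1,2), of p]
proof (elim disjE exE conjE)
  fix w assume "qs = greedy p @ w"
  then show ?thesis using assms(3) by simp
next
  fix u a v w assume *: "greedy p = u @ a # v" "qs = u @ w" "\<forall>b\<in>set w. a < b"
  \<comment> \<open>Equal lengths exclude that qs is a proper prefix of the greedy sequence.\<close>
  then obtain b w' where "w = b # w'" using assms(3) by (cases w) auto
  then show ?thesis using * unfolding lexord_def by auto
qed

end

subsection \<open>Subword complexes labelled by roots\<close>

lemma nths_eq_filter:
  "(\<And>i. i < length L \<Longrightarrow> i \<in> I \<longleftrightarrow> Q (L ! i)) \<Longrightarrow> nths L I = filter Q L"
proof (induction L arbitrary: I)
  case (Cons x L)
  have "nths L {j. Suc j \<in> I} = filter Q L"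
    by (rule Cons.IH) (use Cons.prems in force)
  then show ?case using Cons.prems[of 0] by (simp add: nths_Cons)
qed simp

locale reflection_group = root_basis S \<alpha> \<Phi>
  for S :: "'a set" and \<alpha> :: "'a \<Rightarrow> 'v::euclidean_space" and \<Phi> :: "'v set" +
  fixes W :: "('a, 'b) monoid_scheme" and act :: "'a \<Rightarrow> 'v \<Rightarrow> 'v"
  assumes group_W: "group W" and S_carrier: "S \<subseteq> carrier W"
    and generate_S: "generate W S = carrier W"
    and faithful: "faithful_action W UNIV act"
    and act_S: "t \<in> S \<Longrightarrow> act t = reflection (\<alpha> t)"
begin

section \<open>Transfer between the group and words acting on roots\<close>

lemma word_prod_carrier [simp]: "u \<in> lists S \<Longrightarrow> word_prod W u \<in> carrier W"
proof (induction u)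
  case Nil
  then show ?case using group_W by (simp add: word_prod_def group.is_monoid)
next
  case (Cons x u)
  then show ?case using group_W S_carrier
    by (auto simp: word_prod_def intro!: monoid.m_closed group.is_monoid)
qed

lemma word_prod_Cons: "word_prod W (x # u) = x \<otimes>\<^bsub>W\<^esub> word_prod W u"
  by (simp add: word_prod_def)

lemma word_prod_append:
  "u \<in> lists S \<Longrightarrow> w \<in> lists S \<Longrightarrow> word_prod W (u @ w) = word_prod W u \<otimes>\<^bsub>W\<^esub> word_prod W w"
proof (induction u)
  case Nil
  then show ?case
    using monoid.l_one[OF group.is_monoid[OF group_W], of "word_prod W w"] word_prod_carrier[of w]
    by (simp add: word_prod_def)
next
  case (Cons x u)
  have "x \<in> carrier W" using Cons S_carrier by auto
  then show ?case
    using Cons monoid.m_assoc[OF group.is_monoid[OF group_W], of x "word_prod W u" "word_prod W w"]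
    by (simp add: word_prod_Cons)
qed

lemma act_mult:
  "g \<in> carrier W \<Longrightarrow> h \<in> carrier W \<Longrightarrow> act (g \<otimes>\<^bsub>W\<^esub> h) v = act g (act h v)"
  using group_action.composition_rule[of W UNIV act v g h] faithful
  by (simp add: faithful_action_def)

lemma act_word_prod: "u \<in> lists S \<Longrightarrow> act (word_prod W u) = wact u"
proof (induction u)
  case Nil
  have "act (word_prod W []) = (\<lambda>x\<in>UNIV. x)"
    using group_action.id_eq_one[of W UNIV act] faithful
    by (simp add: faithful_action_def word_prod_def)
  then show ?case by auto
next
  case (Cons x u)
  then have x: "x \<in> S" "u \<in> lists S" "act (word_prod W u) = wact u" by auto
  have "act (word_prod W (x # u)) v = wact (x # u) v" for v
    using act_mult[of x "word_prod W u" v] x S_carrier act_S by (auto simp: word_prod_Cons)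
  then show ?case by blast
qed

text \<open>Faithfulness of the action allows equality in the group to be tested on V.\<close>

lemma word_prod_eq_iff:
  assumes "u \<in> lists S" "w \<in> lists S"
  shows "word_prod W u = word_prod W w \<longleftrightarrow> wact u = wact w"
proof
  assume "wact u = wact w"
  then have "act (word_prod W u) = act (word_prod W w)" using assms act_word_prod by simp
  then show "word_prod W u = word_prod W w"
    using inj_onD[OF faithful_action.faithful[OF faithful]] assms word_prod_carrier by blast
qed (use assms act_word_prod in metis)

lemma ex_word: assumes "g \<in> carrier W" shows "\<exists>u\<in>lists S. word_prod W u = g"
proof -
  have one: "word_prod W [x] = x" if "x \<in> S" for x
    using that S_carrier monoid.r_one[OF group.is_monoid[OF group_W], of x]
    by (auto simp: word_prod_def)
  have "g \<in> generate W S" using assms generate_S by simp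
  then show ?thesis
  proof (induction rule: generate.induct)
    case one
    show ?case by (rule bexI[of _ "[]"]) (simp_all add: word_prod_def)
  next
    case (incl h)
    then show ?case using one by (intro bexI[of _ "[h]"]) auto
  next
    case (inv h)
    \<comment> \<open>Generators act as involutions, so by faithfulness inverses of generators need
      no letters of their own.\<close>
    have "word_prod W [h, h] = word_prod W []"
      using inv by (subst word_prod_eq_iff) (auto simp: fun_eq_iff)
    then have "h \<otimes>\<^bsub>W\<^esub> h = \<one>\<^bsub>W\<^esub>"
      using one[OF inv] word_prod_Cons[of h "[h]"] by (simp add: word_prod_def)
    then have "inv\<^bsub>W\<^esub> h = h" using group.inv_equality[OF group_W] inv S_carrier by blast
    then show ?case using one inv by (intro bexI[of _ "[h]"]) auto
  next
    case (eng g h)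
    then obtain u w where "u \<in> lists S" "w \<in> lists S" "word_prod W u = g" "word_prod W w = h"
      by blast
    then show ?case using word_prod_append by (intro bexI[of _ "u @ w"]) auto
  qed
qed

lemma cox_length_red: assumes "red u" shows "cox_length W S (word_prod W u) = length u"
  unfolding cox_length_def
proof (rule Least_equality)
  have u: "u \<in> lists S" using assms by (simp add: red_def)
  then show "\<exists>ws\<in>lists S. length ws = length u \<and> word_prod W ws = word_prod W u" by blast
  fix k assume "\<exists>ws\<in>lists S. length ws = k \<and> word_prod W ws = word_prod W u"
  then obtain ws where "ws \<in> lists S" "length ws = k" "wact ws = wact u"
    using word_prod_eq_iff u by blast
  then show "length u \<le> k" using red_minimal[OF assms, of ws] by simp
qed

lemma reduced_word_iff: "reduced_word W S u g \<longleftrightarrow> red u \<and> word_prod W u = g"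
proof
  assume r: "reduced_word W S u g"
  then have u: "u \<in> lists S" "word_prod W u = g" "length u = cox_length W S g"
    unfolding reduced_word_def by auto
  obtain u' where u': "red u'" "wact u' = wact u" using ex_red u by blast
  have "word_prod W u' = g" using word_prod_eq_iff[of u' u] u' u by (simp add: red_def)
  then have l: "length u = length u'" using cox_length_red[OF u'(1)] u by simp
  have "red u"
  proof (rule ccontr)
    assume "\<not> red u"
    then obtain w where "w \<in> lists S" "length w < length u" "wact w = wact u"
      using not_red_shorten u by blast
    then show False using red_minimal[OF u'(1), of w] u' l by simp
  qed
  then show "red u \<and> word_prod W u = g" using u by blast
next
  assume "red u \<and> word_prod W u = g"
  then show "reduced_word W S u g" unfolding reduced_word_def
    using cox_length_red[of u] by (auto simp: red_def)
qed

lemma ex_red_word: assumes "g \<in> carrier W" shows "\<exists>u. red u \<and> word_prod W u = g"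
proof -
  obtain u where u: "u \<in> lists S" "word_prod W u = g" using ex_word assms by blast
  then obtain u' where "red u'" "wact u' = wact u" using ex_red by blast
  then show ?thesis using word_prod_eq_iff[of u' u] u by (auto simp: red_def)
qed

text \<open>A reduced word has at most \<open>card P\<close> letters, with equality only if it makes
  all positive roots negative, and such an element is unique.\<close>

lemma longest_element_eq:
  assumes "longest_word u" "red u" shows "longest_element W S = word_prod W u"
  unfolding longest_element_def
proof (rule the_equality)
  have u: "u \<in> lists S" using assms by (simp add: red_def)
  have N: "length u = card P" using assms red_longest_iff by blast
  show "word_prod W u \<in> carrier W \<and>
      (\<forall>g\<in>carrier W. cox_length W S g \<le> cox_length W S (word_prod W u))"
    using u ex_red_word cox_length_red red_length_le N assms(2) by (metis word_prod_carrier)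
  fix g assume g: "g \<in> carrier W \<and> (\<forall>h\<in>carrier W. cox_length W S h \<le> cox_length W S g)"
  then obtain v where v: "red v" "word_prod W v = g" using ex_red_word by blast
  have "card P \<le> length v"
    using g u v cox_length_red[OF v(1)] cox_length_red[OF assms(2)] N by (metis word_prod_carrier)
  then have "longest_word v" using red_longest_iff[OF v(1)] red_length_le[OF v(1)] by simp
  then have "wact v = wact u" using longest_word_unique assms by blast
  then show "g = word_prod W u" using word_prod_eq_iff v u by (auto simp: red_def)
qed

lemma reduced_longest_iff:
  assumes "longest_word u" "red u"
  shows "reduced_word W S w (longest_element W S) \<longleftrightarrow> longest_word w \<and> length w = card P"
proof -
  have u: "u \<in> lists S" using assms by (simp add: red_def)
  have "red w \<and> word_prod W w = word_prod W u \<longleftrightarrow> red w \<and> longest_word w"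
  proof (rule conj_cong)
    assume "red w"
    then have w: "w \<in> lists S" by (simp add: red_def)
    then have "word_prod W w = word_prod W u \<longleftrightarrow> wact u = wact w" using word_prod_eq_iff u by metis
    also have "\<dots> \<longleftrightarrow> longest_word w"
      using longest_word_cong[OF w assms(1)] longest_word_unique[OF assms(1)] by blast
    finally show "word_prod W w = word_prod W u \<longleftrightarrow> longest_word w" .
  qed simp
  also have "\<dots> \<longleftrightarrow> longest_word w \<and> length w = card P"
    using red_longest_iff longest_length_red by blast
  finally show ?thesis unfolding reduced_word_iff longest_element_eq[OF assms] .
qed

section \<open>The sorting word as a greedy word\<close>

abbreviation omega_order :: "'a list \<Rightarrow> 'v \<Rightarrow> 'v \<Rightarrow> bool" where
  "omega_order d b e \<equiv> 0 \<le> omega d b e \<and> (omega d b e = 0 \<longrightarrow> b \<bullet> e = 0)"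

text \<open>Once p is so large that all positive roots are dead, the invariant makes the greedy
  subword a word for the longest element, and \<open>greedy_lexord\<close> makes its positions the
  lexicographically first ones.\<close>

lemma sorting_word:
  assumes "distinct d" "set d = S" "d \<noteq> []"
  shows "red (sorting_word W S d)" "longest_word (sorting_word W S d)"
    and "sorted_wrt (omega_order d) (roots [] (sorting_word W S d))"
    and "\<exists>z. sorting_word W S d = hd d # z"
proof -
  interpret coxeter_word S \<alpha> \<Phi> d
    by unfold_locales (use assms in auto)
  obtain p where p: "\<forall>b\<in>P. \<not> alive p b" using ex_all_dead by blast
  \<comment> \<open>This root is alive at time 0, so p is a successor and position 0 belongs to the
    greedy sequence.\<close>
  have P0: "\<alpha> (letter 0) \<in> P" by simp
  obtain q where q: "p = Suc q" using p P0 by (cases p) auto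
  have L: "longest_word (map letter (greedy p))"
    unfolding longest_word_def using greedy_invariant[of p] p by simp
  note R = greedy_red[of p]
  have lp: "longest_positions W S d ps \<longleftrightarrow>
      sorted_wrt (<) ps \<and> longest_word (map letter ps) \<and> length ps = card P" for ps
    unfolding longest_positions_def letter_def[symmetric]
    using reduced_longest_iff[OF L R, of "map letter ps"] by simp
  have N: "length (greedy p) = card P" using red_longest_iff[OF R] L by simp
  have lpg: "longest_positions W S d (greedy p)" using lp greedy_sorted L N by blast
  have min: "\<forall>qs. longest_positions W S d qs \<longrightarrow> greedy p = qs \<or> (greedy p, qs) \<in> lexord less_than"
  proof (intro allI impI)
    fix qs assume "longest_positions W S d qs"
    then have "sorted_wrt (<) qs" "red (map letter qs)" "length qs = length (greedy p)"
      using lp N longest_length_red by auto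
    then show "greedy p = qs \<or> (greedy p, qs) \<in> lexord less_than" by (rule greedy_lexord)
  qed
  have "sorting_positions W S d = greedy p"
    unfolding sorting_positions_def
  proof (rule the_equality)
    show "longest_positions W S d (greedy p) \<and>
      (\<forall>qs. longest_positions W S d qs \<longrightarrow> greedy p = qs \<or> (greedy p, qs) \<in> lexord less_than)"
      using lpg min by blast
    fix ps assume ps: "longest_positions W S d ps \<and>
      (\<forall>qs. longest_positions W S d qs \<longrightarrow> ps = qs \<or> (ps, qs) \<in> lexord less_than)"
    show "ps = greedy p"
    proof (rule ccontr)
      assume ne: "ps \<noteq> greedy p"
      then have "(ps, greedy p) \<in> lexord less_than" "(greedy p, ps) \<in> lexord less_than"
        using ps lpg min by metis+
      then show False using lexord_asymmetric[OF asym_less_than] by blast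
    qed
  qed
  then have Z: "sorting_word W S d = map letter (greedy p)"
    unfolding sorting_word_def by (simp add: letter_def)
  show "red (sorting_word W S d)" "longest_word (sorting_word W S d)" unfolding Z by (rule R, rule L)
  show "sorted_wrt (omega_order d) (roots [] (sorting_word W S d))"
    unfolding Z using greedy_roots[of p] by blast
  have "letter 0 = hd d" using assms(3) by (simp add: letter_def hd_conv_nth)
  then show "\<exists>z. sorting_word W S d = hd d # z"
    unfolding Z q using greedy_Suc_Cons[of q] by (metis list.simps(9))
qed

lemma longest_roots:
  assumes "red u" "longest_word u" shows "set (roots [] u) = P" "distinct (roots [] u)"
  using red_set_roots[OF assms(1)] red_inversions[OF assms(1)] assms(2)
  unfolding longest_word_def by auto

section \<open>Faces in terms of root labels\<close>

definition labelled_word :: "'a list \<Rightarrow> ('a \<times> 'v) list" where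
  "labelled_word d = map (\<lambda>x. (x, - \<alpha> x)) d @ lab [] (sorting_word W S d)"

text \<open>Vertices are named by labels instead of positions, so that the condition survives
  exchanges of letters.\<close>

definition face :: "('a \<times> 'v) list \<Rightarrow> 'v set \<Rightarrow> bool" where
  "face L B \<longleftrightarrow> B \<subseteq> snd ` set L \<and> contains_longest (map fst (filter (\<lambda>p. snd p \<notin> B) L))"

lemma face_commeq: assumes "commeq L M" shows "face L B \<longleftrightarrow> face M B"
  unfolding face_def
  using commeq_set[OF assms] contains_longest_commeq[OF commeq_filter[OF assms]] by simp

lemma neg_simple_notin_P: "t \<in> S \<Longrightarrow> - \<alpha> t \<notin> P"
  by (simp add: neg_notin_P)

lemma labelled_word_labels:
  assumes "distinct d" "set d = S" "d \<noteq> []"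
  shows "distinct (map snd (labelled_word d))"
    and "snd ` set (labelled_word d) = almost_pos_roots S \<alpha> \<Phi>"
proof -
  note Z = sorting_word[OF assms]
  have "distinct (map (\<lambda>x. - \<alpha> x) d)"
    using assms(1) inj_simple unfolding distinct_map assms(2) by (simp add: inj_on_def)
  moreover have "set (map (\<lambda>x. - \<alpha> x) d) \<inter> P = {}" using neg_simple_notin_P assms(2) by auto
  ultimately show "distinct (map snd (labelled_word d))"
    using longest_roots[OF Z(1,2)] unfolding labelled_word_def by (simp add: comp_def)
  have "snd ` set (lab [] (sorting_word W S d)) = P" using longest_roots[OF Z(1,2)] by simp
  then show "snd ` set (labelled_word d) = almost_pos_roots S \<alpha> \<Phi>"
    unfolding labelled_word_def almost_pos_roots_def using assms(2) by (auto simp: image_Un image_image)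
qed

text \<open>All labels are distinct, hence sets of positions correspond to sets of labels, and
  deleting positions amounts to filtering by label.\<close>

lemma root_subword_complex_iff:
  assumes "distinct d" "set d = S" "d \<noteq> []"
  shows "B \<in> root_subword_complex W S act \<alpha> d \<longleftrightarrow> face (labelled_word d) B"
proof -
  let ?L = "labelled_word d" and ?Z = "sorting_word W S d"
  let ?lr = "\<lambda>i. snd (?L ! i)"
  note Z = sorting_word[OF assms]
  have ZS: "?Z \<in> lists S" using Z(1) by (simp add: red_def)
  have Q: "d @ ?Z = map fst ?L" unfolding labelled_word_def by (simp add: comp_def)
  have lr: "Lr W S act \<alpha> d i = ?lr i" if "i < length ?L" for i
  proof (cases "i < length d")
    case True
    then show ?thesis by (simp add: Lr_def labelled_word_def nth_append)
  next
    case False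
    then have j: "i - length d < length ?Z" using that by (simp add: labelled_word_def)
    have "take (i - length d) ?Z \<in> lists S" using ZS by (auto simp: in_lists_conv_set dest: in_set_takeD)
    then show ?thesis using False j
      by (simp add: Lr_def labelled_word_def nth_append nth_lab act_word_prod Let_def)
  qed
  have inj: "inj_on ?lr {..<length ?L}"
    using labelled_word_labels(1)[OF assms] by (auto simp: inj_on_def distinct_conv_nth)
  have nths: "nths (d @ ?Z) (- X) = map fst (filter (\<lambda>p. snd p \<notin> ?lr ` X) ?L)"
    if X: "X \<subseteq> {..<length ?L}" for X
  proof -
    have "nths ?L (- X) = filter (\<lambda>p. snd p \<notin> ?lr ` X) ?L"
    proof (rule nths_eq_filter)
      fix i assume "i < length ?L"
      then show "i \<in> - X \<longleftrightarrow> snd (?L ! i) \<notin> ?lr ` X"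
        using inj_on_image_mem_iff[OF inj, of i X] X by simp
    qed
    then show ?thesis unfolding Q by (simp add: nths_map)
  qed
  have sc: "X \<in> subword_complex W S (d @ ?Z) (longest_element W S) \<longleftrightarrow>
      X \<subseteq> {..<length ?L} \<and> contains_longest (map fst (filter (\<lambda>p. snd p \<notin> ?lr ` X) ?L))" for X
    unfolding subword_complex_def contains_longest_def reduced_longest_iff[OF Z(2,1)]
    using nths[of X] Q by (auto simp: arg_cong[OF Q, of length, simplified])
  have img: "Lr W S act \<alpha> d ` X = ?lr ` X" if "X \<subseteq> {..<length ?L}" for X
    using lr that by (intro image_cong) auto
  show ?thesis
  proof
    assume "B \<in> root_subword_complex W S act \<alpha> d"
    then obtain X where X: "X \<in> subword_complex W S (d @ ?Z) (longest_element W S)"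
      "B = Lr W S act \<alpha> d ` X"
      unfolding root_subword_complex_def by blast
    then have XL: "X \<subseteq> {..<length ?L}" and B: "B = ?lr ` X" using sc img by auto
    have "B \<subseteq> snd ` set ?L" unfolding B using XL by auto
    then show "face ?L B" unfolding face_def using X(1) sc B by simp
  next
    assume f: "face ?L B"
    define X where "X = {i. i < length ?L \<and> ?lr i \<in> B}"
    have XL: "X \<subseteq> {..<length ?L}" unfolding X_def by auto
    have "B \<subseteq> ?lr ` X"
    proof
      fix b assume b: "b \<in> B"
      then obtain p where p: "p \<in> set ?L" "b = snd p" using f unfolding face_def by blast
      then obtain i where "i < length ?L" "?L ! i = p" by (meson in_set_conv_nth)
      then have "i < length ?L" "b = ?lr i" using p by simp_all
      then show "b \<in> ?lr ` X" using b unfolding X_def by auto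
    qed
    then have B: "?lr ` X = B" unfolding X_def by auto
    have "X \<in> subword_complex W S (d @ ?Z) (longest_element W S)"
      unfolding sc B using f XL unfolding face_def by blast
    then show "B \<in> root_subword_complex W S act \<alpha> d"
      unfolding root_subword_complex_def using img[OF XL] B by blast
  qed
qed

text \<open>The two Coxeter words differ by commutations and so have the same form; both sorting
  words list \<open>P\<close> in an order compatible with it, which is the situation of
  \<open>commeq_lab\<close>.\<close>

lemma commeq_labelled_word:
  assumes d: "distinct d" "set d = S" "d \<noteq> []" and d': "distinct d'" "set d' = S" "d' \<noteq> []"
    and "wact d = wact d'"
  shows "commeq (labelled_word d) (labelled_word d')"
proof -
  have c: "commeq (map (\<lambda>x. (x, - \<alpha> x)) d) (map (\<lambda>x. (x, - \<alpha> x)) d')"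
    by (rule commeq_coxeter_words) (use assms in auto)
  have "omega d = omega d'" using omega_commeq[OF c] by (simp add: comp_def)
  then have s: "sorted_wrt (omega_order d) (roots [] (sorting_word W S d'))"
    using sorting_word(3)[OF d'] by simp
  note Z = sorting_word[OF d] and Z' = sorting_word[OF d']
  have "commeq (lab [] (sorting_word W S d)) (lab [] (sorting_word W S d'))"
  proof (rule commeq_lab[OF _ _ _ Z(3) s])
    fix b e assume "omega_order d b e" "omega_order d e b"
    then show "b \<bullet> e = 0" using omega_swap[of d b e] by simp
  qed (use longest_roots[OF Z(1,2)] longest_roots[OF Z'(1,2)] Z(1) Z'(1) in \<open>auto simp: red_def\<close>)
  then show ?thesis unfolding labelled_word_def using c commeq_append by blast
qed

section \<open>Rotation of an initial letter\<close>

lemma coxeter_reduced: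
  assumes "distinct d" "set d = S" "red u" "wact u = wact d"
  shows "distinct u \<and> set u = S"
proof -
  have uS: "u \<in> lists S" and dS: "d \<in> lists S" using assms by (auto simp: red_def)
  have "t \<in> set u" if t: "t \<in> S" for t
  proof (rule ccontr)
    assume n: "t \<notin> set u"
    obtain A B where d: "d = A @ t # B" using t assms(2) by (metis split_list)
    have S: "A \<in> lists S" "B \<in> lists S" using dS d by auto
    have AB: "t \<notin> set A" "t \<notin> set B" using assms(1) d by auto
    \<comment> \<open>Chosen so that B carries it to \<open>\<alpha> t\<close>: the single letter t
      of d then turns the coordinate at t from 1 to -1, which a word without t cannot do.\<close>
    let ?v = "wact (rev B) (\<alpha> t)"
    have "wact d ?v = wact A (- \<alpha> t)" using S t unfolding d by simp
    then have "coord t (wact d ?v) = - 1" using coord_wact_other[OF S(1) AB(1)] t by simp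
    moreover have "coord t ?v = 1" using coord_wact_other[of "rev B" t] S AB t by simp
    moreover have "coord t (wact u ?v) = coord t ?v" using coord_wact_other[OF uS n] .
    ultimately show False using assms(4) by simp
  qed
  then have su: "set u = S" using uS by auto
  have "length u \<le> length d" using red_minimal assms dS by blast
  then have "length u \<le> card (set u)" using assms(1,2) su distinct_card by metis
  then have "distinct u" using card_length[of u] card_distinct[of u] by simp
  then show ?thesis using su by blast
qed

text \<open>Otherwise \<open>\<alpha> s\<close> is not a root of u, so the reflection s keeps all
  roots of u positive. Then \<open>s # u\<close> is reduced and s lengthens the element.\<close>

lemma initial_not_P:
  assumes "red u" "s \<in> S" "cox_length W S (s \<otimes>\<^bsub>W\<^esub> word_prod W u) < cox_length W S (word_prod W u)"
  shows "wact (rev u) (\<alpha> s) \<notin> P"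
proof
  assume p: "wact (rev u) (\<alpha> s) \<in> P"
  have "refl s b \<in> P" if b: "b \<in> set (roots [] u)" for b
  proof -
    have "b \<noteq> \<alpha> s" using b p red_inversions[OF assms(1)] by blast
    then show ?thesis using b assms(1,2) refl_P unfolding red_def by blast
  qed
  moreover have "roots [] (s # u) = \<alpha> s # map (refl s) (roots [] u)"
    using roots_prefix[of "[s]" "[]" u] by (simp add: lab_prefix)
  ultimately have "red (s # u)" using assms unfolding red_def by auto
  then show False using cox_length_red[OF assms(1)] cox_length_red[of "s # u"] assms(3)
    by (simp add: word_prod_Cons)
qed

text \<open>Here x is the conjugate of s by the longest element. Since the reflection s permutes the
  positive roots other than \<open>\<alpha> s\<close>, these are exactly the roots of z, and a
  letter that extends z to a reduced word can only add \<open>\<alpha> s\<close>.\<close>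

lemma longest_rotate:
  assumes "red (s # z)" "longest_word (s # z)"
  obtains x where "x \<in> S" "red (z @ [x])" "wact z (\<alpha> x) = \<alpha> s" "longest_word (z @ [x])"
    "set (roots [] z) = P - {\<alpha> s}"
proof -
  have S: "s \<in> S" "z \<in> lists S" using assms(1) by (auto simp: red_def)
  have r: "roots [] (s # z) = \<alpha> s # map (refl s) (roots [] z)"
    using roots_prefix[of "[s]" "[]" z] by (simp add: lab_prefix)
  have im: "refl s ` set (roots [] z) = P - {\<alpha> s}"
    using longest_roots[OF assms] unfolding r list.set distinct.simps set_map by blast
  have "refl s ` (P - {\<alpha> s}) = set (roots [] z)"
    unfolding im[symmetric] image_image using S by simp
  moreover have "refl s ` (P - {\<alpha> s}) = P - {\<alpha> s}"
  proof -
    have "refl s ` (P - {\<alpha> s}) \<subseteq> P - {\<alpha> s}"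
    proof (rule image_subsetI)
      fix b assume b: "b \<in> P - {\<alpha> s}"
      have "refl s b \<noteq> \<alpha> s"
      proof
        assume "refl s b = \<alpha> s"
        then have "b = - \<alpha> s" using S by (metis reflection_reflection reflection_self simple_nonzero)
        then show False using b S neg_simple_notin_P by auto
      qed
      then show "refl s b \<in> P - {\<alpha> s}" using refl_P b S by auto
    qed
    moreover have "inj_on (refl s) (P - {\<alpha> s})"
      using S by (metis inj_onI reflection_reflection simple_nonzero)
    ultimately show ?thesis using endo_inj_surj[of "P - {\<alpha> s}" "refl s"] by simp
  qed
  ultimately have rz: "set (roots [] z) = P - {\<alpha> s}" by simp
  then have redz: "red z" using S by (auto simp: red_def)
  have len: "length (s # z) = card P" using assms red_longest_iff by blast
  \<comment> \<open>If z made every simple root negative, it would send no positive root to a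
    positive one; but z is too short to be longest, so some m and its image b are both
    positive.\<close>
  have "\<exists>x\<in>S. wact z (\<alpha> x) \<in> P"
  proof (rule ccontr)
    assume n: "\<not> (\<exists>x\<in>S. wact z (\<alpha> x) \<in> P)"
    have "\<not> longest_word z" using red_longest_iff[OF redz] len by simp
    then obtain b where b: "b \<in> P" "wact (rev z) b \<in> P" using S unfolding longest_word_def by blast
    let ?m = "wact (rev z) b"
    have "coord t b \<le> 0" if t: "t \<in> S" for t
    proof -
      have "b = wact z ?m" using S by simp
      also have "\<dots> = wact z (\<Sum>x\<in>S. coord x ?m *\<^sub>R \<alpha> x)"
        using root_expand[of ?m] P_root b by metis
      also have "\<dots> = (\<Sum>x\<in>S. coord x ?m *\<^sub>R wact z (\<alpha> x))"
        by (simp add: linear_sum[OF linear_wact] linear_scale[OF linear_wact])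
      finally have e: "b = (\<Sum>x\<in>S. coord x ?m *\<^sub>R wact z (\<alpha> x))" .
      have "coord t b = (\<Sum>x\<in>S. coord x ?m * coord t (wact z (\<alpha> x)))"
        by (subst e) (simp add: linear_sum[OF linear_coord] linear_scale[OF linear_coord])
      moreover have "coord t (wact z (\<alpha> x)) \<le> 0" if x: "x \<in> S" for x
      proof -
        have "- wact z (\<alpha> x) \<in> P" using n x S by (simp add: neg_P_iff)
        then show ?thesis using t unfolding P_iff by force
      qed
      moreover have "0 \<le> coord x ?m" if "x \<in> S" for x using b that by (simp add: P_iff)
      ultimately show ?thesis by (simp add: sum_nonpos mult_nonneg_nonpos)
    qed
    then have "coord t b = 0" if "t \<in> S" for t using b that by (force simp: P_iff)
    then show False using root_eq_0 b P_root by blast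
  qed
  then obtain x where x: "x \<in> S" "wact z (\<alpha> x) \<in> P" by blast
  have redx: "red (z @ [x])" using redz x by (simp add: red_snoc)
  have "wact z (\<alpha> x) \<notin> set (roots [] z)" using red_inversions[OF redz] S x by (metis simple_P wact_rev_wact)
  then have "wact z (\<alpha> x) = \<alpha> s" using rz x by blast
  moreover have "longest_word (z @ [x])" using red_longest_iff[OF redx] len by simp
  ultimately show thesis using that x redx rz by blast
qed

text \<open>Cancelling s in front, or x at the end, of a word for the longest element leaves a word
  for the element of z, to which the other letter can be attached. Subwords that do not use the
  moved letter are unaffected.\<close>

lemma contains_longest_rotate:
  assumes "s \<in> S" "x \<in> S" "longest_word (s # z)" "longest_word (z @ [x])"
  shows "contains_longest (s # w) \<longleftrightarrow> contains_longest (w @ [x])"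
proof
  assume "contains_longest (s # w)"
  then obtain u where u: "longest_word u" "length u = card P" "subseq u (s # w)"
    unfolding contains_longest_def by blast
  show "contains_longest (w @ [x])"
  proof (cases "\<exists>u'. u = s # u' \<and> subseq u' w")
    case True
    then obtain u' where u': "u = s # u'" "subseq u' w" by blast
    have "refl s (wact u' v) = refl s (wact z v)" for v
      using longest_word_unique[OF u(1) assms(3)] unfolding u' by (metis wact_simps(2))
    then have "wact u' v = wact z v" for v using assms(1) by (metis reflection_reflection simple_nonzero)
    then have "wact (z @ [x]) = wact (u' @ [x])" by (simp add: fun_eq_iff)
    moreover have "u' @ [x] \<in> lists S" using u(1) u' assms(2) by (simp add: longest_word_def)
    ultimately have "longest_word (u' @ [x])" using longest_word_cong assms(4) by blast
    moreover have "subseq (u' @ [x]) (w @ [x])" using u'(2) by simp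
    ultimately show ?thesis unfolding contains_longest_def using u u' by (intro exI[of _ "u' @ [x]"]) simp
  next
    case False
    then have "subseq u w" using u(3) by (cases u) (auto split: if_splits)
    then have "subseq u (w @ [x])" using list_emb_append_mono[of "(=)" u w "[]" "[x]"] by simp
    then show ?thesis unfolding contains_longest_def using u by blast
  qed
next
  assume "contains_longest (w @ [x])"
  then obtain u where u: "longest_word u" "length u = card P" "subseq u (w @ [x])"
    unfolding contains_longest_def by blast
  obtain a b where ab: "u = a @ b" "subseq a w" "subseq b [x]" using subseq_append_split u(3) by blast
  have "b = [] \<or> b = [x]" using ab(3) by (cases b) (auto split: if_splits)
  then show "contains_longest (s # w)"
  proof
    assume "b = []"
    then have "subseq u (s # w)" using ab by (simp add: list_emb_Cons)
    then show ?thesis unfolding contains_longest_def using u by blast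
  next
    assume b: "b = [x]"
    have "wact a (refl x v) = wact z (refl x v)" for v
      using longest_word_unique[OF u(1) assms(4)] unfolding ab(1) b by (metis wact_simps)
    then have "wact a v = wact z v" for v using assms(2) by (metis reflection_reflection simple_nonzero)
    then have "wact (s # z) = wact (s # a)" by (simp add: fun_eq_iff)
    moreover have "s # a \<in> lists S" using u(1) ab assms(1) by (simp add: longest_word_def)
    ultimately have "longest_word (s # a)" using longest_word_cong assms(3) by blast
    then show ?thesis unfolding contains_longest_def using u ab b by (intro exI[of _ "s # a"]) simp
  qed
qed

lemma sigma_P: "s \<in> S \<Longrightarrow> b \<in> P \<Longrightarrow> root_sigma S act \<alpha> s b = refl s b"
  unfolding root_sigma_def using act_S neg_notin_P[of b] by auto

lemma sigma_neg_simple: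
  assumes "s \<in> S" "t \<in> S"
  shows "root_sigma S act \<alpha> s (- \<alpha> t) = (if t = s then \<alpha> s else - \<alpha> t)"
proof (cases "t = s")
  case True
  have "\<alpha> s \<notin> {\<alpha> t | t. t \<in> S \<and> t \<noteq> s}" using inj_onD[OF inj_simple, of s] assms(1) by blast
  then show ?thesis using True assms(1) act_S unfolding root_sigma_def
    by (auto simp: reflection_minus)
next
  case False
  then have "\<alpha> t \<in> {\<alpha> t | t. t \<in> S \<and> t \<noteq> s}" using assms(2) by blast
  then show ?thesis using False unfolding root_sigma_def by simp
qed

lemma sigma_sigma:
  assumes "s \<in> S" "b \<in> almost_pos_roots S \<alpha> \<Phi>"
  shows "root_sigma S act \<alpha> s (root_sigma S act \<alpha> s b) = b"
proof -
  consider "b = \<alpha> s" | "b \<in> P" "b \<noteq> \<alpha> s" | t where "t \<in> S" "b = - \<alpha> t"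
    using assms(2) unfolding almost_pos_roots_def by auto
  then show ?thesis
  proof cases
    case 1
    then show ?thesis using assms(1) by (simp add: sigma_P sigma_neg_simple)
  next
    case 2
    then show ?thesis using assms(1) refl_P[of b s] by (simp add: sigma_P)
  next
    case 3
    then show ?thesis using assms(1) by (simp add: sigma_P sigma_neg_simple)
  qed
qed

text \<open>Dropping the first letter s with label \<open>- \<alpha> s\<close>, appending x with
  label \<open>\<alpha> s\<close> and applying \<open>root_sigma\<close> to the other labels gives
  M. By \<open>commeq_lab\<close> this is the labelled word of \<open>d @ [s]\<close> up to
  commutations.\<close>

lemma face_rotate:
  assumes d: "distinct (s # d)" "set (s # d) = S" and B: "B \<subseteq> almost_pos_roots S \<alpha> \<Phi>"
  shows "face (labelled_word (s # d)) B \<longleftrightarrow>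
    face (labelled_word (d @ [s])) (root_sigma S act \<alpha> s ` B)"
proof -
  let ?sg = "root_sigma S act \<alpha> s" and ?neg = "map (\<lambda>x. (x, - \<alpha> x))"
  have d': "distinct (d @ [s])" "set (d @ [s]) = S" using d by auto
  have s: "s \<in> S" using d(2) by (metis list.set_intros(1))
  obtain z where z: "sorting_word W S (s # d) = s # z" using sorting_word(4)[OF d] by auto
  note Z = sorting_word(1-3)[OF d, simplified z, simplified]
  note Z' = sorting_word(1-3)[OF d', simplified]
  have zS: "z \<in> lists S" using Z(1) by (simp add: red_def)
  obtain x where x: "x \<in> S" "red (z @ [x])" "wact z (\<alpha> x) = \<alpha> s" "longest_word (z @ [x])"
    "set (roots [] z) = P - {\<alpha> s}"
    using longest_rotate[OF Z(1,2)] by blast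
  \<comment> \<open>The part that stays in place. The s that opens the sorting word becomes the last
    letter of \<open>d @ [s]\<close>, its label \<open>\<alpha> s\<close> turning into
    \<open>- \<alpha> s\<close>.\<close>
  define T where "T = ?neg d @ (s, \<alpha> s) # lab [s] z"
  have L: "labelled_word (s # d) = (s, - \<alpha> s) # T"
    unfolding labelled_word_def z T_def by simp
  define M where "M = ?neg (d @ [s]) @ lab [] (z @ [x])"
  have rs: "roots [s] z = map (refl s) (roots [] z)"
    using roots_prefix[of "[s]" "[]" z] by (simp add: lab_prefix)
  have rz: "roots [] z = map (refl s) (roots [s] z)"
    unfolding rs using s by (simp add: comp_def)
  have rsP: "set (roots [s] z) \<subseteq> P" using Z(1) unfolding red_def by simp
  have rzx: "roots [] (z @ [x]) = roots [] z @ [\<alpha> s]" using x(3) roots_snoc by metis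
  \<comment> \<open>For pairs of roots of z this is the order of the old sorting word carried over
    by \<open>omega_rotate\<close>; the final root \<open>\<alpha> s\<close> is covered by
    \<open>omega_final\<close>.\<close>
  have sz: "sorted_wrt (\<lambda>b e. 0 \<le> omega (d @ [s]) b e) (roots [] (z @ [x]))"
  proof -
    have "sorted_wrt (omega_order (s # d)) (roots [s] z)" using Z(3) by simp
    then have "sorted_wrt (\<lambda>b e. 0 \<le> omega (d @ [s]) (refl s b) (refl s e)) (roots [s] z)"
    proof (rule sorted_wrt_mono_rel[rotated])
      fix b e assume "b \<in> set (roots [s] z)" "e \<in> set (roots [s] z)" "omega_order (s # d) b e"
      then show "0 \<le> omega (d @ [s]) (refl s b) (refl s e)"
        using omega_rotate[OF d, of b e] rsP P_root by (metis subsetD)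
    qed
    then have "sorted_wrt (\<lambda>b e. 0 \<le> omega (d @ [s]) b e) (roots [] z)"
      unfolding rz by (simp add: sorted_wrt_map)
    moreover have "0 \<le> omega (d @ [s]) b (\<alpha> s)" if "b \<in> set (roots [] z)" for b
      using omega_final[OF d, of b] that x(5) by blast
    ultimately show ?thesis unfolding rzx by (auto simp: sorted_wrt_append)
  qed
  have "commeq (lab [] (sorting_word W S (d @ [s]))) (lab [] (z @ [x]))"
  proof (rule commeq_lab[OF _ _ _ Z'(3) sz])
    fix b e assume "omega_order (d @ [s]) b e" "0 \<le> omega (d @ [s]) e b"
    then show "b \<bullet> e = 0" using omega_swap[of "d @ [s]" b e] by simp
  qed (use longest_roots[OF x(2,4)] longest_roots[OF Z'(1,2)] Z'(1) x(2) in \<open>auto simp: red_def\<close>)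
  then have cM: "commeq (labelled_word (d @ [s])) M"
    unfolding labelled_word_def M_def using commeq_append commeq_refl by blast
  have Mst: "M = map (map_prod id ?sg) T @ [(x, \<alpha> s)]"
  proof -
    have "map (map_prod id ?sg) (lab [s] z) = lab [] z"
    proof -
      have l: "lab [] z = map (map_prod id (refl s)) (lab [s] z)"
        using lab_prefix[of "[s]" "[]" z] s by (simp add: comp_def map_prod_def case_prod_beta)
      show ?thesis unfolding l
      proof (rule map_cong)
        fix p assume "p \<in> set (lab [s] z)"
        then have "snd p \<in> P" using rsP by auto
        then show "map_prod id ?sg p = map_prod id (refl s) p"
          using sigma_P[OF s] by (cases p) simp
      qed simp
    qed
    moreover have "?sg (- \<alpha> t) = - \<alpha> t" if "t \<in> set d" for t
    proof -
      have "t \<in> S" using d(2) that by (metis list.set_intros(2))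
      then show ?thesis using sigma_neg_simple[OF s] that d(1) by auto
    qed
    moreover have "?sg (\<alpha> s) = - \<alpha> s" using s by (simp add: sigma_P)
    ultimately show ?thesis unfolding M_def T_def using x(3) by (simp add: lab_append)
  qed
  have apr: "snd ` set ((s, - \<alpha> s) # T) = almost_pos_roots S \<alpha> \<Phi>"
    using labelled_word_labels(2)[OF d] unfolding L by simp
  have mem: "?sg b \<in> ?sg ` B \<longleftrightarrow> b \<in> B" if "b \<in> almost_pos_roots S \<alpha> \<Phi>" for b
  proof
    assume "?sg b \<in> ?sg ` B"
    then obtain e where e: "e \<in> B" "?sg b = ?sg e" by blast
    have "b = ?sg (?sg b)" using sigma_sigma[OF s that] by simp
    also have "\<dots> = e" unfolding e(2) using sigma_sigma[OF s] e(1) B by blast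
    finally show "b \<in> B" using e(1) by simp
  qed (rule imageI)
  have sgs: "?sg (- \<alpha> s) = \<alpha> s" using s by (simp add: sigma_neg_simple)
  have sub: "?sg ` B \<subseteq> snd ` set M"
  proof -
    have "snd ` set M = ?sg ` snd ` set ((s, - \<alpha> s) # T)"
      unfolding Mst by (auto simp: image_image sgs)
    then show ?thesis unfolding apr using B by blast
  qed
  let ?w = "map fst (filter (\<lambda>p. snd p \<notin> B) T)"
  have "filter ((\<lambda>p. snd p \<notin> ?sg ` B) \<circ> map_prod id ?sg) T = filter (\<lambda>p. snd p \<notin> B) T"
  proof (rule filter_cong)
    fix p assume "p \<in> set T"
    then have "snd p \<in> almost_pos_roots S \<alpha> \<Phi>" unfolding apr[symmetric] by simp
    then show "((\<lambda>p. snd p \<notin> ?sg ` B) \<circ> map_prod id ?sg) p = (snd p \<notin> B)" using mem by simp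
  qed simp
  then have w: "map fst (filter (\<lambda>p. snd p \<notin> ?sg ` B) (map (map_prod id ?sg) T)) = ?w"
    by (simp add: filter_map comp_def)
  \<comment> \<open>The new last letter is deleted exactly when the old first one was. If both are
    deleted, the remaining words coincide; otherwise they differ by one rotation.\<close>
  have sB: "\<alpha> s \<in> ?sg ` B \<longleftrightarrow> - \<alpha> s \<in> B" using mem[of "- \<alpha> s"] s sgs unfolding almost_pos_roots_def by auto
  have "face M (?sg ` B) \<longleftrightarrow> contains_longest (?w @ (if - \<alpha> s \<in> B then [] else [x]))"
    unfolding face_def using sub w sB unfolding Mst by simp
  moreover have "face ((s, - \<alpha> s) # T) B \<longleftrightarrow> contains_longest ((if - \<alpha> s \<in> B then [] else [s]) @ ?w)"
    unfolding face_def using B apr by simp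
  ultimately show ?thesis
    unfolding L using face_commeq[OF cM] contains_longest_rotate[OF s x(1) Z(2) x(4), of ?w] by simp
qed

end

theorem theorem5p7:
  fixes W :: "('a, 'b) monoid_scheme"
    and S :: "'a set"
    and act :: "'a \<Rightarrow> 'v::euclidean_space \<Rightarrow> 'v"
    and \<alpha> :: "'a \<Rightarrow> 'v"
    and \<Phi> :: "'v set"
    and c c' s :: 'a
    and cw cw' :: "'a list"
    and \<beta>1 \<beta>2 :: 'v
  assumes "finite_coxeter_system W S"
    and "reflection_action W S act \<alpha> \<Phi>"
    and "coxeter_element W S c"
    and "reduced_word W S cw c"
    and "initial_letter W S s c"
    and "c' = s \<otimes>\<^bsub>W\<^esub> c \<otimes>\<^bsub>W\<^esub> s"
    and "reduced_word W S cw' c'"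
    and "\<beta>1 \<in> almost_pos_roots S \<alpha> \<Phi>"
    and "\<beta>2 \<in> almost_pos_roots S \<alpha> \<Phi>"
  shows "{\<beta>1, \<beta>2} \<in> root_subword_complex W S act \<alpha> cw \<longleftrightarrow>
         {root_sigma S act \<alpha> s \<beta>1, root_sigma S act \<alpha> s \<beta>2} \<in> root_subword_complex W S act \<alpha> cw'"
proof -
  interpret reflection_group S \<alpha> \<Phi> W act
    using assms(1,2)
    unfolding finite_coxeter_system_def coxeter_system_def reflection_action_def
    by (intro reflection_group.intro root_basis.intro reflection_group_axioms.intro) auto
  have s: "s \<in> S" using assms(5) by (simp add: initial_letter_def)
  obtain ws where ws: "distinct ws" "set ws = S" "word_prod W ws = c"
    using assms(3) unfolding coxeter_element_def by blast
  have cw: "red cw" "word_prod W cw = c" using assms(4) reduced_word_iff by auto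
  have cwS: "cw \<in> lists S" and wsS: "ws \<in> lists S" using cw ws by (auto simp: red_def)
  have "wact cw = wact ws" using word_prod_eq_iff[OF cwS wsS] cw ws by simp
  then have dc: "distinct cw" "set cw = S" using coxeter_reduced[OF ws(1,2) cw(1)] by simp_all
  obtain A B where AB: "cw = A @ s # B" using s dc(2) by (metis split_list)
  have ABS: "A \<in> lists S" "B \<in> lists S" using cwS AB by auto
  have "wact (rev cw) (\<alpha> s) \<notin> P"
    using initial_not_P[OF cw(1) s] assms(5) cw(2) by (simp add: initial_letter_def)
  then have orth: "\<alpha> y \<bullet> \<alpha> s = 0" if "y \<in> set A" for y
    using initial_orthogonal[of A s B y] cwS dc(1) AB that by simp
  define d where "d = A @ B"
  \<comment> \<open>The letters before the initial letter s commute with it, so s can be brought to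
    the front without changing c.\<close>
  have wcw: "wact cw = wact (s # d)"
    using commeq_wact[OF commeq_front[OF ABS(1) s orth, where B = B and h = "\<lambda>_. ()"]]
    unfolding AB d_def by (simp add: comp_def)
  have d: "distinct (s # d)" "set (s # d) = S" using dc unfolding AB d_def by auto
  have d': "distinct (d @ [s])" "set (d @ [s]) = S" using d by auto
  have dS: "d \<in> lists S" using ABS unfolding d_def by simp
  have cw': "red cw'" "word_prod W cw' = c'" using assms(7) reduced_word_iff by auto
  have c': "c' = word_prod W (s # cw @ [s])"
  proof -
    have one: "word_prod W [s] = s"
      using s S_carrier monoid.r_one[OF group.is_monoid[OF group_W], of s]
      by (auto simp: word_prod_def)
    have "word_prod W ((s # cw) @ [s]) = word_prod W (s # cw) \<otimes>\<^bsub>W\<^esub> word_prod W [s]"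
      by (rule word_prod_append) (use cwS s in auto)
    then show ?thesis unfolding assms(6) using one cw(2) by (simp add: word_prod_Cons)
  qed
  \<comment> \<open>In \<open>s # cw @ [s]\<close> the leading s cancels against the s brought to
    the front of \<open>cw\<close>.\<close>
  have wcw': "wact cw' = wact (d @ [s])"
  proof -
    have "wact cw' = wact (s # cw @ [s])"
      using word_prod_eq_iff[of cw' "s # cw @ [s]"] cw' c' cwS s by (simp add: red_def)
    also have "\<dots> = wact (d @ [s])" using wcw s by (simp add: fun_eq_iff)
    finally show ?thesis .
  qed
  then have dc': "distinct cw'" "set cw' = S" using coxeter_reduced[OF d' cw'(1)] by auto
  have ne: "cw \<noteq> []" "cw' \<noteq> []" using dc dc' s by auto
  let ?B = "{\<beta>1, \<beta>2}"
  \<comment> \<open>The given words are replaced by \<open>s # d\<close> and \<open>d @ [s]\<close>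
    up to commutations, which keep the labels; only the rotation between these two changes
    labels.\<close>
  have "?B \<in> root_subword_complex W S act \<alpha> cw \<longleftrightarrow> face (labelled_word cw) ?B"
    using root_subword_complex_iff[OF dc ne(1)] .
  also have "\<dots> \<longleftrightarrow> face (labelled_word (s # d)) ?B"
    by (rule face_commeq, rule commeq_labelled_word) (use dc ne d wcw in auto)
  also have "\<dots> \<longleftrightarrow> face (labelled_word (d @ [s])) (root_sigma S act \<alpha> s ` ?B)"
    by (rule face_rotate[OF d]) (use assms(8,9) in auto)
  also have "\<dots> \<longleftrightarrow> face (labelled_word cw') (root_sigma S act \<alpha> s ` ?B)"
    by (rule face_commeq, rule commeq_labelled_word) (use dc' ne d' wcw' in auto)
  also have "\<dots> \<longleftrightarrow> root_sigma S act \<alpha> s ` ?B \<in> root_subword_complex W S act \<alpha> cw'"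
    using root_subword_complex_iff[OF dc' ne(2)] by simp
  finally show ?thesis by simp
qed

end
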